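(* Let $N\ge 0$ be an integer and suppose that $V^{(N)}\in\mathbb{C}^{(N+1)\times(N+1)}$ is the Vandermonde matrix, with entries $V^{(N)}_{jk}=z_j^k$ ($0\le j,k\le N$), associated with $N+1$ distinct interpolation points $Z=\{z_j\}_{j=0,1,\dots,N}\subset\mathbb{C}$. Suppose further that $\Omega\subset\mathbb{C}$ is a simply connected compact set such that $Z\subset\Omega$. Then $$\lVert(V^{(N)})^{-1}\rVert_2\le\rho_*^N\Lambda_N,$$ where $\rho_*$ is the parameter of $\Omega$ defined in the context and $\Lambda_N$ denotes the Lebesgue constant for the set of interpolation points $Z$ over $\Omega$.
   Context: $\lVert\cdot\rVert_2$ is the operator norm induced by the Euclidean norm, and $\lVert g\rVert_{L^\infty(\Omega)}=\sup_{z\in\Omega}|g(z)|$. Lebesgue constant: for distinct points $Z=\{z_j\}_{j=0}^N\subset\Omega$, $$\Lambda_N:=\sup_{F\in C(\Omega),\,F\ne 0}\frac{\lVert P_N[F]\rVert_{L^\infty(\Omega)}}{\lVert F\rVert_{L^\infty(\Omega)}},$$ where $P_N[F]$ is the polynomial of degree at most $N$ interpolating $F$ at the points of $Z$. Level sets: for a simply connected compact set $\Omega\subset\mathbb{C}$ (identified with a subset of $\mathbb{R}^2$) and $\rho>1$, let $E_\rho:=\{x+iy\in\mathbb{C}:G(x,y)=\log\rho\}$, where $G:\mathbb{R}^2\to\mathbb{R}$ is the unique solution of the exterior Laplace problem $$\nabla^2G=0\ \text{in }\mathbb{R}^2\setminus\Omega,\qquad G=0\ \text{on }\partial\Omega,\qquad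 G(x,y)\sim\log r\ \text{as }r:=\sqrt{x^2+y^2}\to\infty.$$ It is understood that $\Omega$ consists of more than one point, so that $G$ exists. Let $E_\rho^o$ denote the bounded open region with boundary $E_\rho$ (i.e. $\Omega\cup\{x+iy\notin\Omega:G(x,y)<\log\rho\}$). The parameter $\rho_*$: $\rho_*:=\inf\{\rho>1:D_1\subset E_\rho^o\}$, where $D_1$ is the open unit disk centered at the origin. *)

theory Defs
  imports
    "HOL-Analysis.Analysis"
    "HOL-Library.Landau_Symbols"
    "HOL-Computational_Algebra.Polynomial"
    "Jordan_Normal_Form.Gauss_Jordan_Elimination"
begin

definition vandermonde :: "nat \<Rightarrow> (nat \<Rightarrow> complex) \<Rightarrow> complex mat" where
  "vandermonde N z = mat (N + 1) (N + 1) (\<lambda>(j, k). z j ^ k)"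

definition vec_norm2 :: "complex vec \<Rightarrow> real" where
  "vec_norm2 v = L2_set (\<lambda>i. cmod (vec_index v i)) {..<dim_vec v}"

definition op_norm2 :: "complex mat \<Rightarrow> real" where
  "op_norm2 A = (SUP v \<in> carrier_vec (dim_col A) - {0\<^sub>v (dim_col A)}.
     vec_norm2 (A *\<^sub>v v) / vec_norm2 v)"

definition sup_norm :: "complex set \<Rightarrow> (complex \<Rightarrow> complex) \<Rightarrow> real" where
  "sup_norm \<Omega> g = (SUP w \<in> \<Omega>. cmod (g w))"

definition interp_poly ::
  "nat \<Rightarrow> (nat \<Rightarrow> complex) \<Rightarrow> (complex \<Rightarrow> complex) \<Rightarrow> complex poly" where
  "interp_poly N z F = (THE p. degree p \<le> N \<and> (\<forall>j\<le>N. poly p (z j) = F (z j)))"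

text \<open>Only the values of \<open>F\<close> on \<open>\<Omega>\<close> matter, so \<open>F \<noteq> 0\<close> in \<open>C(\<Omega>)\<close> means that
  \<open>F\<close> does not vanish identically on \<open>\<Omega>\<close>.\<close>

definition lebesgue_constant :: "nat \<Rightarrow> (nat \<Rightarrow> complex) \<Rightarrow> complex set \<Rightarrow> real" where
  "lebesgue_constant N z \<Omega> =
     (SUP F \<in> {F. continuous_on \<Omega> F \<and> (\<exists>w\<in>\<Omega>. F w \<noteq> 0)}.
        sup_norm \<Omega> (poly (interp_poly N z F)) / sup_norm \<Omega> F)"

text \<open>A twice continuously differentiable function with vanishing Laplacian; \<open>\<real>\<^sup>2\<close> is
  identified with the complex plane.\<close>

definition harmonic_on :: "(complex \<Rightarrow> real) \<Rightarrow> complex set \<Rightarrow> bool" where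
  "harmonic_on u S \<longleftrightarrow> (\<exists>ux uy uxx uxy uyx uyy.
     (\<forall>w\<in>S. (u has_derivative (\<lambda>h. ux w * Re h + uy w * Im h)) (at w) \<and>
            (ux has_derivative (\<lambda>h. uxx w * Re h + uxy w * Im h)) (at w) \<and>
            (uy has_derivative (\<lambda>h. uyx w * Re h + uyy w * Im h)) (at w)) \<and>
     continuous_on S uxx \<and> continuous_on S uxy \<and>
     continuous_on S uyx \<and> continuous_on S uyy \<and>
     (\<forall>w\<in>S. uxx w + uyy w = 0))"

text \<open>The exterior Laplace problem. It does not determine \<open>G\<close> in the interior of \<open>\<Omega>\<close>;
  extending \<open>G\<close> by \<open>0\<close> there makes the solution unique as a function on the whole plane.
  Since \<open>\<Omega>\<close> is closed, vanishing on \<open>\<Omega>\<close> includes the boundary condition, which is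
  attained continuously because \<open>G\<close> is required to be continuous.\<close>

definition solves_exterior_laplace :: "complex set \<Rightarrow> (complex \<Rightarrow> real) \<Rightarrow> bool" where
  "solves_exterior_laplace \<Omega> G \<longleftrightarrow>
     continuous_on UNIV G \<and> harmonic_on G (- \<Omega>) \<and> (\<forall>w\<in>\<Omega>. G w = 0) \<and>
     G \<sim>[at_infinity] (\<lambda>w. ln (cmod w))"

definition green_function :: "complex set \<Rightarrow> complex \<Rightarrow> real" where
  "green_function \<Omega> = (THE G. solves_exterior_laplace \<Omega> G)"

text \<open>The open region bounded by the level curve \<open>{w. green_function \<Omega> w = ln \<rho>}\<close>.\<close>

definition level_region :: "complex set \<Rightarrow> real \<Rightarrow> complex set" where
  "level_region \<Omega> \<rho> = \<Omega> \<union> {w. w \<notin> \<Omega> \<and> green_function \<Omega> w < ln \<rho>}"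

definition rho_star :: "complex set \<Rightarrow> real" where
  "rho_star \<Omega> = Inf {\<rho>. \<rho> > 1 \<and> ball 0 1 \<subseteq> level_region \<Omega> \<rho>}"

end

theory Submission
  imports Defs "HOL-Complex_Analysis.Complex_Analysis" "Jordan_Normal_Form.Determinant"
begin

text \<open>If \<open>p\<close> has the coefficient vector \<open>V\<^sup>-\<^sup>1 v\<close>, then \<open>p\<close> interpolates data \<open>v\<close>, which a Tietze
  extension realises without increasing the maximum, so \<open>|p|\<close> is at most \<open>\<Lambda>\<^sub>N \<parallel>v\<parallel>\<^sub>2\<close> on \<open>\<Omega>\<close>. The
  Bernstein-Walsh inequality carries this to the unit disc at the cost of \<open>\<rho>\<^sub>*\<^sup>N\<close>, and Parseval's
  identity at the roots of unity bounds the coefficients of \<open>p\<close> by its maximum on the unit circle.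
  The Green function is \<open>- ln |f (1 / (w - a))|\<close> for a Riemann map \<open>f\<close> of the inverted exterior of
  \<open>\<Omega>\<close>; it vanishes on the bounded components of the complement, which a simply connected compact
  set may have (the Warsaw circle).\<close>

section \<open>Harmonic functions and the maximum principle\<close>

text \<open>\<open>green_function\<close> is a definite description, so nothing is known about it
  until the exterior problem is shown to have exactly one solution. Existence is delicate at the
  boundary, because a Riemann map need not extend continuously to it; but its modulus tends to 1
  there, since the preimages of smaller closed discs are compact, and this is all that the boundary
  values of \<open>G\<close> require.

  The normalisation at infinity fixes \<open>G\<close> only up to an error o(ln |w|), which might be
  unbounded. Comparisons at infinity are therefore made with a coefficient of \<open>G\<close>
  altered by \<epsilon>, which is sent to 0 only at the end.

  No further factor depending on \<open>N\<close> enters, because both changes of norm are free: an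
  entry of \<open>v\<close> is at most its Euclidean norm, and averaging |p|^2 over N + 1 roots of
  unity is exact for degree at most N.\<close>

lemma local_max_second_deriv_nonpos:
  fixes g g' :: "real \<Rightarrow> real"
  assumes "r > 0" and der: "\<And>t. \<bar>t\<bar> < r \<Longrightarrow> (g has_real_derivative g' t) (at t)"
    and der2: "(g' has_real_derivative d) (at 0)"
    and max: "\<And>t. \<bar>t\<bar> < r \<Longrightarrow> g t \<le> g 0"
  shows "d \<le> 0"
proof (rule ccontr)
  assume "\<not> d \<le> 0"
  then obtain e where e: "e > 0" "\<And>h. 0 < h \<Longrightarrow> h < e \<Longrightarrow> g' 0 < g' h"
    using DERIV_pos_inc_right[OF der2] by auto
  have "g' 0 = 0"
    using DERIV_local_max[OF der[of 0] \<open>r > 0\<close>] max \<open>r > 0\<close> by simp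
  define h where "h = min e r / 2"
  have h: "0 < h" "h < e" "h < r" using e \<open>r > 0\<close> by (auto simp: h_def)
  \<comment> \<open>A positive derivative of \<open>g'\<close> at its zero 0 makes \<open>g'\<close>
    positive just to the right, so the mean value theorem gives \<open>g h > g 0\<close>.\<close>
  have "\<exists>\<xi>. 0 < \<xi> \<and> \<xi> < h \<and> g h - g 0 = (h - 0) * g' \<xi>"
    by (rule MVT2) (use h der in auto)
  then obtain \<xi> where "0 < \<xi>" "\<xi> < h" "g h - g 0 = h * g' \<xi>" by auto
  moreover have "g' \<xi> > 0" using e(2)[of \<xi>] \<open>g' 0 = 0\<close> calculation h by simp
  moreover have "g h \<le> g 0" using max h by simp
  ultimately show False using h by (smt (verit) mult_pos_pos)
qed

lemma harmonic_on_subset: "harmonic_on u S \<Longrightarrow> T \<subseteq> S \<Longrightarrow> harmonic_on u T"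
  unfolding harmonic_on_def
  by (elim exE conjE, intro exI conjI) (auto intro: continuous_on_subset)

lemma harmonic_on_linear_combination:
  assumes "harmonic_on u S" "harmonic_on v S"
  shows "harmonic_on (\<lambda>w. a * u w + b * v w) S"
proof -
  obtain ux uy uxx uxy uyx uyy where u:
    "\<And>w. w \<in> S \<Longrightarrow> (u has_derivative (\<lambda>h. ux w * Re h + uy w * Im h)) (at w)"
    "\<And>w. w \<in> S \<Longrightarrow> (ux has_derivative (\<lambda>h. uxx w * Re h + uxy w * Im h)) (at w)"
    "\<And>w. w \<in> S \<Longrightarrow> (uy has_derivative (\<lambda>h. uyx w * Re h + uyy w * Im h)) (at w)"
    "continuous_on S uxx" "continuous_on S uxy" "continuous_on S uyx" "continuous_on S uyy"
    "\<And>w. w \<in> S \<Longrightarrow> uxx w + uyy w = 0"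
    using assms(1) unfolding harmonic_on_def by blast
  obtain vx vy vxx vxy vyx vyy where v:
    "\<And>w. w \<in> S \<Longrightarrow> (v has_derivative (\<lambda>h. vx w * Re h + vy w * Im h)) (at w)"
    "\<And>w. w \<in> S \<Longrightarrow> (vx has_derivative (\<lambda>h. vxx w * Re h + vxy w * Im h)) (at w)"
    "\<And>w. w \<in> S \<Longrightarrow> (vy has_derivative (\<lambda>h. vyx w * Re h + vyy w * Im h)) (at w)"
    "continuous_on S vxx" "continuous_on S vxy" "continuous_on S vyx" "continuous_on S vyy"
    "\<And>w. w \<in> S \<Longrightarrow> vxx w + vyy w = 0"
    using assms(2) unfolding harmonic_on_def by blast
  have comb: "((\<lambda>w. a * f w + b * g w) has_derivative
      (\<lambda>h. (a * fx + b * gx) * Re h + (a * fy + b * gy) * Im h)) (at w)"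
    if "(f has_derivative (\<lambda>h. fx * Re h + fy * Im h)) (at w)"
       "(g has_derivative (\<lambda>h. gx * Re h + gy * Im h)) (at w)"
    for f g :: "complex \<Rightarrow> real" and fx fy gx gy w
    by (rule has_derivative_eq_rhs, (rule derivative_intros that)+) (simp add: fun_eq_iff algebra_simps)
  have trace: "(a * uxx w + b * vxx w) + (a * uyy w + b * vyy w) = 0" if "w \<in> S" for w
  proof -
    have "(a * uxx w + b * vxx w) + (a * uyy w + b * vyy w)
        = a * (uxx w + uyy w) + b * (vxx w + vyy w)" by (simp add: algebra_simps)
    then show ?thesis using u(8) v(8) that by simp
  qed
  show ?thesis
    unfolding harmonic_on_def
    apply (rule exI[of _ "\<lambda>w. a * ux w + b * vx w"], rule exI[of _ "\<lambda>w. a * uy w + b * vy w"],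
        rule exI[of _ "\<lambda>w. a * uxx w + b * vxx w"], rule exI[of _ "\<lambda>w. a * uxy w + b * vxy w"],
        rule exI[of _ "\<lambda>w. a * uyx w + b * vyx w"], rule exI[of _ "\<lambda>w. a * uyy w + b * vyy w"])
    apply (intro conjI ballI comb u v trace continuous_intros)
    apply assumption+
    done
qed

lemma harmonic_on_const: "harmonic_on (\<lambda>_. c) S"
  unfolding harmonic_on_def by (intro exI[of _ "\<lambda>_. 0"]) auto

text \<open>The Cauchy-Riemann equations. The second claim is there because the y-derivative of ln
  |f| is the negative imaginary part of f'/f, which has to be differentiated once more.\<close>

lemma has_derivative_Re_field:
  assumes "(f has_field_derivative d) (at w)"
  shows "((\<lambda>w. Re (f w)) has_derivative (\<lambda>h. Re d * Re h + (- Im d) * Im h)) (at w)"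
    and "((\<lambda>w. - Im (f w)) has_derivative (\<lambda>h. (- Im d) * Re h + (- Re d) * Im h)) (at w)"
  using assms unfolding has_field_derivative_def
  by (auto intro!: derivative_eq_intros simp: fun_eq_iff algebra_simps)

text \<open>Locally ln |f| is the real part of a logarithm of \<open>f\<close>. Its gradient comes
  from f'/f, which is defined on all of \<open>S\<close>, so no global branch of the logarithm is
  involved.\<close>

lemma harmonic_on_ln_cmod:
  assumes "open S" and hol: "f holomorphic_on S" and nz: "\<And>w. w \<in> S \<Longrightarrow> f w \<noteq> 0"
  shows "harmonic_on (\<lambda>w. ln (cmod (f w))) S"
proof -
  define g where "g = (\<lambda>w. deriv f w / f w)"
  have g: "g holomorphic_on S"
    unfolding g_def using nz by (intro holomorphic_intros holomorphic_deriv hol \<open>open S\<close>) auto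
  have dg: "(g has_field_derivative deriv g w) (at w)" if "w \<in> S" for w
    using holomorphic_derivI[OF g \<open>open S\<close> that] .
  have cont: "continuous_on S (deriv g)"
    using holomorphic_on_imp_continuous_on[OF holomorphic_deriv[OF g \<open>open S\<close>]] .
  have main: "((\<lambda>w. ln (cmod (f w))) has_derivative
      (\<lambda>h. Re (g w) * Re h + (- Im (g w)) * Im h)) (at w)" if w: "w \<in> S" for w
  proof -
    \<comment> \<open>Division by the constant \<open>f w\<close> moves the value at
      \<open>w\<close> to 1, away from the branch cut of \<open>Ln\<close>.\<close>
    have "((\<lambda>x. Ln (f x / f w)) has_field_derivative g w) (at w)"
      using holomorphic_derivI[OF hol \<open>open S\<close> w] nz[OF w]
      by (auto intro!: derivative_eq_intros simp: g_def)
    then have "((\<lambda>x. Re (Ln (f x / f w)) + ln (cmod (f w))) has_derivative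
        (\<lambda>h. Re (g w) * Re h + (- Im (g w)) * Im h)) (at w)"
      by (intro has_derivative_add_const has_derivative_Re_field)
    then show ?thesis
      by (rule has_derivative_transform_within_open[OF _ \<open>open S\<close> w])
        (use nz w in \<open>auto simp: Re_Ln norm_divide ln_div\<close>)
  qed
  show ?thesis
    unfolding harmonic_on_def
    apply (rule exI[of _ "\<lambda>w. Re (g w)"], rule exI[of _ "\<lambda>w. - Im (g w)"],
        rule exI[of _ "\<lambda>w. Re (deriv g w)"], rule exI[of _ "\<lambda>w. - Im (deriv g w)"],
        rule exI[of _ "\<lambda>w. - Im (deriv g w)"], rule exI[of _ "\<lambda>w. - Re (deriv g w)"])
    using main has_derivative_Re_field[OF dg] cont
    by (auto intro!: continuous_intros)
qed

text \<open>The square raises the Laplacian from 0 to 4 \<delta> > 0, whereas at a local maximum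
  both pure second derivatives are nonpositive. Without this perturbation the second derivative test
  would give no contradiction.\<close>

lemma harmonic_plus_square_no_local_max:
  assumes "open V" "harmonic_on u V" "w \<in> V" "\<delta> > 0" "r > 0"
  shows "\<exists>x \<in> ball w r. u w + \<delta> * (cmod w)\<^sup>2 < u x + \<delta> * (cmod x)\<^sup>2"
proof (rule ccontr)
  assume "\<not> ?thesis"
  then have max: "u x + \<delta> * (cmod x)\<^sup>2 \<le> u w + \<delta> * (cmod w)\<^sup>2" if "dist w x < r" for x
    using that by (auto simp: not_less)
  obtain s where "s > 0" and s: "ball w s \<subseteq> V"
    using assms openE by blast
  define t0 where "t0 = min r s"
  have "t0 > 0" using \<open>s > 0\<close> \<open>r > 0\<close> by (simp add: t0_def)
  obtain ux uy uxx uxy uyx uyy where u: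
    "\<And>w. w \<in> V \<Longrightarrow> (u has_derivative (\<lambda>h. ux w * Re h + uy w * Im h)) (at w)"
    "\<And>w. w \<in> V \<Longrightarrow> (ux has_derivative (\<lambda>h. uxx w * Re h + uxy w * Im h)) (at w)"
    "\<And>w. w \<in> V \<Longrightarrow> (uy has_derivative (\<lambda>h. uyx w * Re h + uyy w * Im h)) (at w)"
    "\<And>w. w \<in> V \<Longrightarrow> uxx w + uyy w = 0"
    using assms(2) unfolding harmonic_on_def by blast
  have along: "((\<lambda>t. v (w + of_real t * e)) has_real_derivative (p * Re e + q * Im e)) (at t)"
    if "(v has_derivative (\<lambda>h. p * Re h + q * Im h)) (at (w + of_real t * e))"
    for v :: "complex \<Rightarrow> real" and p q t e
  proof -
    have "((\<lambda>t. w + of_real t * e) has_derivative (\<lambda>h. of_real h * e)) (at t)"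
      by (auto intro!: derivative_eq_intros)
    from has_derivative_compose[OF this that] show ?thesis
      unfolding has_field_derivative_def
      by (rule has_derivative_eq_rhs) (simp add: fun_eq_iff algebra_simps)
  qed
  have inV: "w + of_real t * e \<in> V" "dist w (w + of_real t * e) < r"
    if "\<bar>t\<bar> < t0" "cmod e = 1" for t e
    using that s by (auto simp: t0_def dist_norm norm_mult subset_iff)
  have "uxx w + \<delta> * 2 \<le> 0"
  proof (rule local_max_second_deriv_nonpos[OF \<open>t0 > 0\<close>])
    fix t :: real assume t: "\<bar>t\<bar> < t0"
    show "((\<lambda>t. u (w + of_real t * 1) + \<delta> * (cmod (w + of_real t * 1))\<^sup>2) has_real_derivative
        ux (w + of_real t * 1) + \<delta> * (2 * (Re w + t))) (at t)"
      using along[OF u(1)[OF inV(1)[OF t, of 1]]]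
      by (auto intro!: derivative_eq_intros simp: cmod_power2)
    show "u (w + of_real t * 1) + \<delta> * (cmod (w + of_real t * 1))\<^sup>2
        \<le> u (w + of_real 0 * 1) + \<delta> * (cmod (w + of_real 0 * 1))\<^sup>2"
      using max[OF inV(2)[OF t, of 1]] by simp
  next
    show "((\<lambda>t. ux (w + of_real t * 1) + \<delta> * (2 * (Re w + t))) has_real_derivative uxx w + \<delta> * 2) (at 0)"
      using along[of ux "uxx w" "uxy w" 0 1] u(2)[OF \<open>w \<in> V\<close>]
      by (auto intro!: derivative_eq_intros)
  qed
  moreover have "uyy w + \<delta> * 2 \<le> 0"
  proof (rule local_max_second_deriv_nonpos[OF \<open>t0 > 0\<close>])
    fix t :: real assume t: "\<bar>t\<bar> < t0"
    show "((\<lambda>t. u (w + of_real t * \<i>) + \<delta> * (cmod (w + of_real t * \<i>))\<^sup>2) has_real_derivative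
        uy (w + of_real t * \<i>) + \<delta> * (2 * (Im w + t))) (at t)"
      using along[OF u(1)[OF inV(1)[OF t, of "\<i>"]]]
      by (auto intro!: derivative_eq_intros simp: cmod_power2)
    show "u (w + of_real t * \<i>) + \<delta> * (cmod (w + of_real t * \<i>))\<^sup>2
        \<le> u (w + of_real 0 * \<i>) + \<delta> * (cmod (w + of_real 0 * \<i>))\<^sup>2"
      using max[OF inV(2)[OF t, of "\<i>"]] by simp
  next
    show "((\<lambda>t. uy (w + of_real t * \<i>) + \<delta> * (2 * (Im w + t))) has_real_derivative uyy w + \<delta> * 2) (at 0)"
      using along[of uy "uyx w" "uyy w" 0 "\<i>"] u(3)[OF \<open>w \<in> V\<close>]
      by (auto intro!: derivative_eq_intros)
  qed
  ultimately show False using u(4)[OF \<open>w \<in> V\<close>] \<open>\<delta> > 0\<close> by linarith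
qed

text \<open>\<open>V\<close> may be unbounded. The condition at infinity confines the positive
  values of \<open>u\<close> to a disc, where a small multiple of the square is harmless and
  compactness yields a maximum.\<close>

lemma harmonic_maximum_principle:
  assumes "open V" and harm: "harmonic_on u V" and cont: "continuous_on (closure V) u"
    and bdry: "\<And>w. w \<in> frontier V \<Longrightarrow> u w \<le> 0"
    and infty: "eventually (\<lambda>w. w \<in> V \<longrightarrow> u w \<le> 0) at_infinity" and "w0 \<in> V"
  shows "u w0 \<le> 0"
proof (rule ccontr)
  assume "\<not> u w0 \<le> 0"
  obtain R0 where R0: "\<And>w. w \<in> V \<Longrightarrow> R0 \<le> cmod w \<Longrightarrow> u w \<le> 0"
    using infty by (auto simp: eventually_at_infinity)
  define R where "R = max R0 1"
  have R: "R > 0" "\<And>w. w \<in> V \<Longrightarrow> R \<le> cmod w \<Longrightarrow> u w \<le> 0" using R0 by (auto simp: R_def)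
  \<comment> \<open>Within radius \<open>R\<close> the square term adds at most half of
    \<open>u w0\<close>, so \<open>u\<close> is still positive at a maximum point of
    \<open>v\<close>. That keeps the point off the frontier and off the circle of radius
    \<open>R\<close>.\<close>
  define \<delta> where "\<delta> = u w0 / (2 * R\<^sup>2)"
  have "\<delta> > 0" "\<delta> * R\<^sup>2 < u w0" using \<open>\<not> u w0 \<le> 0\<close> \<open>R > 0\<close> by (auto simp: \<delta>_def field_simps)
  define v where "v = (\<lambda>w. u w + \<delta> * (cmod w)\<^sup>2)"
  have "cmod w0 < R" using R(2)[OF \<open>w0 \<in> V\<close>] \<open>\<not> u w0 \<le> 0\<close> by fastforce
  have "w0 \<in> closure V \<inter> cball 0 R"
    using \<open>w0 \<in> V\<close> closure_subset \<open>cmod w0 < R\<close> by auto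
  moreover have "compact (closure V \<inter> cball 0 R)"
    by (intro closed_Int_compact) auto
  moreover have "continuous_on (closure V \<inter> cball 0 R) v"
    unfolding v_def by (intro continuous_intros continuous_on_subset[OF cont]) auto
  ultimately obtain w1 where w1: "w1 \<in> closure V" "cmod w1 \<le> R"
    and max: "\<And>x. x \<in> closure V \<Longrightarrow> cmod x \<le> R \<Longrightarrow> v x \<le> v w1"
    using continuous_attains_sup[of "closure V \<inter> cball 0 R" v] by fastforce
  have "v w0 \<le> v w1" using max[of w0] \<open>w0 \<in> V\<close> closure_subset \<open>cmod w0 < R\<close> by auto
  moreover have "\<delta> * (cmod w1)\<^sup>2 \<le> \<delta> * R\<^sup>2" using w1 \<open>\<delta> > 0\<close> by (auto intro!: mult_left_mono power_mono)
  moreover have "u w0 \<le> v w0" using \<open>\<delta> > 0\<close> by (simp add: v_def)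
  ultimately have "u w1 > 0" using \<open>\<delta> * R\<^sup>2 < u w0\<close> by (simp add: v_def)
  then have "w1 \<in> V"
    using bdry[of w1] w1(1) by (force simp: frontier_def interior_open[OF \<open>open V\<close>])
  then have "cmod w1 < R" using R(2)[of w1] \<open>u w1 > 0\<close> by force
  obtain r where "r > 0" and r: "ball w1 r \<subseteq> V \<inter> ball 0 R"
    using openE[of "V \<inter> ball 0 R" w1] \<open>open V\<close> \<open>w1 \<in> V\<close> \<open>cmod w1 < R\<close> by auto
  obtain x where "x \<in> ball w1 r" "v w1 < v x"
    using harmonic_plus_square_no_local_max[OF \<open>open V\<close> harm \<open>w1 \<in> V\<close> \<open>\<delta> > 0\<close> \<open>r > 0\<close>]
    unfolding v_def by blast
  moreover have "x \<in> closure V" "cmod x \<le> R"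
    using r \<open>x \<in> ball w1 r\<close> closure_subset[of V] by (auto simp: subset_iff)
  ultimately show False using max[of x] by simp
qed

section \<open>Uniqueness of the Green function and the Bernstein-Walsh inequality\<close>

lemma ln_cmod_at_infinity: "filterlim (\<lambda>w::complex. ln (cmod w)) at_top at_infinity"
  by (rule filterlim_compose[OF ln_at_top filterlim_norm_at_top])

lemma exterior_laplace_near_ln:
  assumes "solves_exterior_laplace \<Omega> G" "\<delta> > 0"
  shows "eventually (\<lambda>w. \<bar>G w - ln (cmod w)\<bar> \<le> \<delta> * ln (cmod w)) at_infinity"
proof -
  have "(\<lambda>w. G w - ln (cmod w)) \<in> o[at_infinity](\<lambda>w. ln (cmod w))"
    using assms(1) by (intro asymp_equiv_imp_diff_smallo) (simp add: solves_exterior_laplace_def)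
  from landau_o.smallD[OF this \<open>\<delta> > 0\<close>]
  have "eventually (\<lambda>w. \<bar>G w - ln (cmod w)\<bar> \<le> \<delta> * \<bar>ln (cmod w)\<bar>) at_infinity"
    by simp
  moreover have "eventually (\<lambda>w::complex. ln (cmod w) > 0) at_infinity"
    using ln_cmod_at_infinity by (simp add: filterlim_at_top_dense)
  ultimately show ?thesis by eventually_elim simp
qed

lemma exterior_laplace_maximum_principle:
  assumes "closed \<Omega>" "harmonic_on u (- \<Omega>)" "continuous_on UNIV u"
    and "\<And>w. w \<in> \<Omega> \<Longrightarrow> u w \<le> 0" "eventually (\<lambda>w. u w \<le> 0) at_infinity"
  shows "u w \<le> 0"
proof (cases "w \<in> \<Omega>")
  case False
  show ?thesis
  proof (rule harmonic_maximum_principle[of "- \<Omega>" u])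
    show "u x \<le> 0" if "x \<in> frontier (- \<Omega>)" for x
      using that assms(1,4) frontier_subset_closed by auto
    show "eventually (\<lambda>w. w \<in> - \<Omega> \<longrightarrow> u w \<le> 0) at_infinity"
      using assms(5) by (rule eventually_mono) simp
  qed (use assms False in \<open>auto intro: continuous_on_subset\<close>)
qed (use assms in auto)

lemma exterior_laplace_nonneg:
  assumes "closed \<Omega>" and G: "solves_exterior_laplace \<Omega> G"
  shows "G w \<ge> 0"
proof -
  \<comment> \<open>The negative of \<open>G\<close> is written as a two-term combination to match
    \<open>harmonic_on_linear_combination\<close>.\<close>
  have "(-1) * G w + 0 * G w \<le> 0"
  proof (rule exterior_laplace_maximum_principle[OF \<open>closed \<Omega>\<close>, of "\<lambda>w. (-1) * G w + 0 * G w"])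
    show "harmonic_on (\<lambda>w. (-1) * G w + 0 * G w) (- \<Omega>)"
      using G by (intro harmonic_on_linear_combination) (auto simp: solves_exterior_laplace_def)
    \<comment> \<open>A relative error of 1 is already enough for \<open>G\<close> to be nonnegative
      near infinity.\<close>
    have "eventually (\<lambda>w. \<bar>G w - ln (cmod w)\<bar> \<le> 1 * ln (cmod w)) at_infinity"
      by (rule exterior_laplace_near_ln[OF G]) simp
    then show "eventually (\<lambda>w. (-1) * G w + 0 * G w \<le> 0) at_infinity"
      by eventually_elim simp
  qed (use G in \<open>auto simp: solves_exterior_laplace_def intro!: continuous_intros\<close>)
  then show ?thesis by simp
qed

text \<open>The difference of two solutions is only known to be o(ln |w|), so its sign at infinity
  is unclear. Scaling \<open>G\<close> by \<open>1 - \<epsilon>\<close> makes the difference tend to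
  minus infinity like - \<epsilon> ln |w|.\<close>

lemma exterior_laplace_le:
  assumes "closed \<Omega>" and G: "solves_exterior_laplace \<Omega> G" and G': "solves_exterior_laplace \<Omega> G'"
  shows "G w \<le> G' w"
proof -
  have main: "(1 - \<epsilon>) * G w \<le> G' w" if \<epsilon>: "0 < \<epsilon>" "\<epsilon> < 1" for \<epsilon>
  proof -
    have "(1 - \<epsilon>) * G w + (-1) * G' w \<le> 0"
    proof (rule exterior_laplace_maximum_principle[OF \<open>closed \<Omega>\<close>, of "\<lambda>w. (1 - \<epsilon>) * G w + (-1) * G' w"])
      show "harmonic_on (\<lambda>w. (1 - \<epsilon>) * G w + (-1) * G' w) (- \<Omega>)"
        using G G' by (intro harmonic_on_linear_combination) (auto simp: solves_exterior_laplace_def)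
      \<comment> \<open>The tolerance \<epsilon>/2 on both sides fits because (1 - \<epsilon>)(1 +
        \<epsilon>/2) \<le> 1 - \<epsilon>/2.\<close>
      have "eventually (\<lambda>w. \<bar>G w - ln (cmod w)\<bar> \<le> \<epsilon>/2 * ln (cmod w)) at_infinity"
        "eventually (\<lambda>w. \<bar>G' w - ln (cmod w)\<bar> \<le> \<epsilon>/2 * ln (cmod w)) at_infinity"
        by (rule exterior_laplace_near_ln[OF G] exterior_laplace_near_ln[OF G'], use \<epsilon> in simp)+
      moreover have "eventually (\<lambda>w::complex. ln (cmod w) > 0) at_infinity"
        using ln_cmod_at_infinity by (simp add: filterlim_at_top_dense)
      ultimately show "eventually (\<lambda>w. (1 - \<epsilon>) * G w + (-1) * G' w \<le> 0) at_infinity"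
      proof eventually_elim
        case (elim x)
        have "(1 - \<epsilon>) * G x \<le> (1 - \<epsilon>) * ((1 + \<epsilon>/2) * ln (cmod x))"
        proof (rule mult_left_mono)
          have "G x - ln (cmod x) \<le> \<epsilon>/2 * ln (cmod x)" using elim(1) by linarith
          then show "G x \<le> (1 + \<epsilon>/2) * ln (cmod x)" by (simp add: algebra_simps)
        qed (use \<epsilon> in simp)
        also have "\<dots> = (1 - \<epsilon>/2 - \<epsilon> * \<epsilon> / 2) * ln (cmod x)" by (simp add: field_simps)
        also have "\<dots> \<le> (1 - \<epsilon>/2) * ln (cmod x)"
          using elim by (intro mult_right_mono) auto
        also have "\<dots> = ln (cmod x) - \<epsilon>/2 * ln (cmod x)" by (simp add: algebra_simps)
        also have "\<dots> \<le> G' x" using elim(2) by linarith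
        finally show ?case by simp
      qed
    qed (use G G' in \<open>auto simp: solves_exterior_laplace_def intro!: continuous_intros\<close>)
    then show ?thesis by simp
  qed
  have "((\<lambda>\<epsilon>. (1 - \<epsilon>) * G w) \<longlongrightarrow> (1 - 0) * G w) (at_right 0)"
    by (intro tendsto_intros)
  moreover have "eventually (\<lambda>\<epsilon>. (1 - \<epsilon>) * G w \<le> G' w) (at_right 0)"
    using main by (auto simp: eventually_at_right[of 0 1] intro!: exI[of _ 1])
  ultimately have "(1 - 0) * G w \<le> G' w"
    by (rule tendsto_upperbound) simp
  then show ?thesis by simp
qed

lemma exterior_laplace_unique:
  assumes "closed \<Omega>" "solves_exterior_laplace \<Omega> G" "solves_exterior_laplace \<Omega> G'"
  shows "G = G'"
  using exterior_laplace_le[OF assms] exterior_laplace_le[OF assms(1,3,2)] by (intro ext antisym)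

text \<open>On the region where \<open>|p| > M\<close> the function \<open>ln |p|\<close> is harmonic although \<open>p\<close> may have zeros
  elsewhere; comparing it there with \<open>(N + \<epsilon>) G\<close>, which wins at infinity, gives the bound.\<close>

lemma Bernstein_Walsh:
  assumes "closed \<Omega>" and G: "solves_exterior_laplace \<Omega> G"
    and "M > 0" and M: "\<And>w. w \<in> \<Omega> \<Longrightarrow> cmod (poly p w) \<le> M" and "degree p \<le> N"
  shows "cmod (poly p w) \<le> M * exp (real N * G w)"
proof (cases "cmod (poly p w) \<le> M")
  case True
  also have "M * 1 \<le> M * exp (real N * G w)"
    using \<open>M > 0\<close> exterior_laplace_nonneg[OF \<open>closed \<Omega>\<close> G, of w] by (intro mult_left_mono) auto
  finally show ?thesis by simp
next
  case False
  define V where "V = {w. M < cmod (poly p w)}"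
  have "w \<in> V" using False by (simp add: V_def)
  have "open V" unfolding V_def by (intro open_Collect_less continuous_intros)
  have "V \<subseteq> - \<Omega>" using M by (force simp: V_def)
  have "closed {w. M \<le> cmod (poly p w)}" by (intro closed_Collect_le continuous_intros)
  \<comment> \<open>As |p| \<ge> M > 0 holds on the closure too, ln |p| is continuous up to the
    frontier, where |p| equals \<open>M\<close> and the comparison function reduces to a negative
    multiple of \<open>G\<close>.\<close>
  then have clV: "closure V \<subseteq> {w. M \<le> cmod (poly p w)}"
    by (intro closure_minimal) (auto simp: V_def)
  have contG: "continuous_on UNIV G" and harmG: "harmonic_on G (- \<Omega>)"
    using G by (auto simp: solves_exterior_laplace_def)
  define C where "C = (\<Sum>i\<le>degree p. cmod (coeff p i))"
  have growth: "cmod (poly p x) \<le> C * cmod x ^ N" if "cmod x \<ge> 1" for x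
  proof -
    have "cmod (poly p x) \<le> (\<Sum>i\<le>degree p. cmod (coeff p i) * cmod x ^ i)"
      unfolding poly_altdef by (rule norm_sum[THEN order_trans]) (simp add: norm_mult norm_power)
    also have "\<dots> \<le> (\<Sum>i\<le>degree p. cmod (coeff p i) * cmod x ^ N)"
      using \<open>degree p \<le> N\<close> that by (intro sum_mono mult_left_mono power_increasing) auto
    finally show ?thesis by (simp add: C_def sum_distrib_right)
  qed
  have "p \<noteq> 0" using False \<open>M > 0\<close> by auto
  then have "0 < cmod (coeff p (degree p))" by simp
  also have "\<dots> \<le> C" unfolding C_def by (rule member_le_sum) auto
  finally have "C > 0" .
  have main: "ln (cmod (poly p w)) \<le> (real N + \<epsilon>) * G w + ln M" if "\<epsilon> > 0" for \<epsilon>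
  proof -
    \<comment> \<open>With exactly \<open>N\<close> copies of \<open>G\<close> the leading
      logarithms may cancel and leave an error o(ln |w|) of either sign; the surplus \<epsilon>
      beats it.\<close>
    define a where "a = real N + \<epsilon>"
    have "a > 0" using that by (simp add: a_def)
    define u where "u = (\<lambda>w. 1 * ln (cmod (poly p w)) + 1 * ((- a) * G w + (- ln M) * 1))"
    have "u w \<le> 0"
    proof (rule harmonic_maximum_principle[OF \<open>open V\<close> _ _ _ _ \<open>w \<in> V\<close>])
      show "harmonic_on u V"
        unfolding u_def
        by (intro harmonic_on_linear_combination harmonic_on_const harmonic_on_ln_cmod \<open>open V\<close>
            harmonic_on_subset[OF harmG \<open>V \<subseteq> - \<Omega>\<close>] holomorphic_intros)
          (use \<open>M > 0\<close> in \<open>auto simp: V_def\<close>)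
      show "continuous_on (closure V) u"
        unfolding u_def
        by (intro continuous_intros continuous_on_subset[OF contG]) (use clV \<open>M > 0\<close> in force)+
      show "u x \<le> 0" if "x \<in> frontier V" for x
      proof -
        have "x \<in> closure V" "x \<notin> V"
          using that by (auto simp: frontier_def interior_open[OF \<open>open V\<close>])
        then have "cmod (poly p x) = M" using clV by (force simp: V_def)
        moreover have "G x \<ge> 0" by (rule exterior_laplace_nonneg[OF \<open>closed \<Omega>\<close> G])
        ultimately show ?thesis using \<open>a > 0\<close> by (simp add: u_def)
      qed
      \<comment> \<open>Chosen so that \<open>a * (1 - \<delta>) = real N + \<epsilon> / 2\<close>.
        Half of the surplus pays for the relative error of \<open>G\<close>, the other half for the
        constant \<open>ln C - ln M\<close>; the latter dictates the threshold
        \<open>(ln C - ln M) * (2 / \<epsilon>)\<close>.\<close>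
      define \<delta> where "\<delta> = \<epsilon> / (2 * a)"
      have "\<delta> > 0" "a * \<delta> = \<epsilon> / 2" using \<open>\<epsilon> > 0\<close> \<open>a > 0\<close> by (auto simp: \<delta>_def)
      have "eventually (\<lambda>w. \<bar>G w - ln (cmod w)\<bar> \<le> \<delta> * ln (cmod w)) at_infinity"
        by (rule exterior_laplace_near_ln[OF G \<open>\<delta> > 0\<close>])
      moreover have "eventually (\<lambda>w::complex. ln (cmod w) \<ge> max 1 ((ln C - ln M) * (2 / \<epsilon>))) at_infinity"
        using ln_cmod_at_infinity unfolding filterlim_at_top by blast
      moreover have "eventually (\<lambda>w::complex. cmod w \<ge> 1) at_infinity"
        by (auto simp: eventually_at_infinity)
      ultimately show "eventually (\<lambda>w. w \<in> V \<longrightarrow> u w \<le> 0) at_infinity"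
      proof eventually_elim
        case (elim x)
        show ?case
        proof
          assume "x \<in> V"
          then have pos: "0 < cmod (poly p x)" using \<open>M > 0\<close> by (auto simp: V_def)
          have "0 < cmod x" using elim(3) by linarith
          have "ln (cmod (poly p x)) \<le> ln (C * cmod x ^ N)"
            using growth[OF elim(3)] pos by (intro ln_mono) auto
          also have "\<dots> = ln C + real N * ln (cmod x)"
            using \<open>C > 0\<close> \<open>0 < cmod x\<close> by (simp add: ln_mult ln_realpow)
          finally have 1: "ln (cmod (poly p x)) \<le> ln C + real N * ln (cmod x)" .
          have "a * ((1 - \<delta>) * ln (cmod x)) \<le> a * G x"
            using elim(1) \<open>a > 0\<close> by (intro mult_left_mono) (auto simp: algebra_simps)
          moreover have "a * ((1 - \<delta>) * ln (cmod x)) = (a - a * \<delta>) * ln (cmod x)"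
            by (simp add: algebra_simps)
          moreover have "a - a * \<delta> = real N + \<epsilon> / 2"
            using \<open>a * \<delta> = \<epsilon> / 2\<close> by (simp add: a_def)
          ultimately have 2: "(real N + \<epsilon> / 2) * ln (cmod x) \<le> a * G x" by metis
          have "(ln C - ln M) * (2 / \<epsilon>) \<le> ln (cmod x)" using elim(2) by simp
          then have "ln C - ln M \<le> \<epsilon> / 2 * ln (cmod x)"
            using \<open>\<epsilon> > 0\<close> by (simp add: field_simps)
          with 1 2 show "u x \<le> 0" by (simp add: u_def algebra_simps)
        qed
      qed
    qed
    then show ?thesis by (simp add: u_def a_def algebra_simps)
  qed
  have "((\<lambda>\<epsilon>. (real N + \<epsilon>) * G w + ln M) \<longlongrightarrow> (real N + 0) * G w + ln M) (at_right 0)"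
    by (intro tendsto_intros)
  moreover have "eventually (\<lambda>\<epsilon>. ln (cmod (poly p w)) \<le> (real N + \<epsilon>) * G w + ln M) (at_right 0)"
    using main by (auto simp: eventually_at_right[of 0 1] intro!: exI[of _ 1])
  ultimately have "ln (cmod (poly p w)) \<le> (real N + 0) * G w + ln M"
    by (rule tendsto_lowerbound) simp
  moreover have "0 < cmod (poly p w)" using False \<open>M > 0\<close> by linarith
  ultimately have "cmod (poly p w) \<le> exp (real N * G w + ln M)"
    by (metis add_0_right exp_le_cancel_iff exp_ln)
  then show ?thesis using \<open>M > 0\<close> by (simp add: exp_add mult.commute)
qed

section \<open>Existence of the Green function\<close>

text \<open>The exterior of \<open>\<Omega>\<close>, with the point at infinity, in the coordinate \<open>\<zeta> = 1 / (w - a)\<close>.\<close>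

definition inverted_exterior :: "complex set \<Rightarrow> complex \<Rightarrow> complex set" where
  "inverted_exterior \<Omega> a = {\<zeta>. \<zeta> = 0 \<or> a + inverse \<zeta> \<in> outside \<Omega>}"

text \<open>Makes infinity an interior point: everything outside a large disc about \<open>a\<close>
  lies in \<open>outside \<Omega>\<close>.\<close>

lemma inverted_exterior_near_0:
  assumes "compact \<Omega>"
  obtains r where "r > 0" "ball 0 r \<subseteq> inverted_exterior \<Omega> a"
proof -
  have "bounded (- outside \<Omega>)"
    using assms by (intro cobounded_outside compact_imp_bounded)
  then obtain B where "B > 0" and B: "- outside \<Omega> \<subseteq> ball a B"
    using bounded_subset_ballD by blast
  have "ball 0 (inverse B) \<subseteq> inverted_exterior \<Omega> a"
  proof
    fix \<zeta> :: complex assume "\<zeta> \<in> ball 0 (inverse B)"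
    then have "cmod \<zeta> < inverse B" by simp
    show "\<zeta> \<in> inverted_exterior \<Omega> a"
    proof (cases "\<zeta> = 0")
      case False
      then have "B < inverse (cmod \<zeta>)"
        using \<open>cmod \<zeta> < inverse B\<close> \<open>B > 0\<close>
        by (metis inverse_inverse_eq less_imp_inverse_less zero_less_norm_iff)
      then have "a + inverse \<zeta> \<notin> ball a B" by (simp add: dist_norm norm_inverse)
      then show ?thesis using B by (auto simp: inverted_exterior_def)
    qed (simp add: inverted_exterior_def)
  qed
  with \<open>B > 0\<close> show thesis by (intro that[of "inverse B"]) auto
qed

lemma open_inverted_exterior:
  assumes "compact \<Omega>"
  shows "open (inverted_exterior \<Omega> a)"
proof -
  obtain r where r: "r > 0" "ball 0 r \<subseteq> inverted_exterior \<Omega> a"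
    using inverted_exterior_near_0[OF assms] .
  define P where "P = (- {0}) \<inter> (\<lambda>\<zeta>. a + inverse \<zeta>) -` outside \<Omega>"
  have "open P"
    unfolding P_def using assms
    by (intro continuous_open_preimage open_outside compact_imp_closed continuous_intros) auto
  moreover have "inverted_exterior \<Omega> a = ball 0 r \<union> P"
    using r by (auto simp: P_def inverted_exterior_def)
  ultimately show ?thesis by (simp add: open_Un)
qed

text \<open>The inversion maps the connected set \<open>outside \<Omega>\<close> onto the domain
  without 0, and 0 is a limit point of that image, so adjoining it preserves connectedness.\<close>

lemma connected_inverted_exterior:
  assumes "compact \<Omega>" "a \<in> \<Omega>"
  shows "connected (inverted_exterior \<Omega> a)"
proof -
  define T where "T = (\<lambda>w. inverse (w - a)) ` outside \<Omega>"
  have a: "a \<notin> outside \<Omega>" using assms(2) outside_no_overlap by blast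
  have T: "\<zeta> \<in> T \<longleftrightarrow> \<zeta> \<noteq> 0 \<and> \<zeta> \<in> inverted_exterior \<Omega> a" for \<zeta>
  proof
    show "\<zeta> \<in> T \<Longrightarrow> \<zeta> \<noteq> 0 \<and> \<zeta> \<in> inverted_exterior \<Omega> a"
      using a by (auto simp: T_def inverted_exterior_def)
    assume "\<zeta> \<noteq> 0 \<and> \<zeta> \<in> inverted_exterior \<Omega> a"
    then have "a + inverse \<zeta> \<in> outside \<Omega>" "\<zeta> = inverse ((a + inverse \<zeta>) - a)"
      by (auto simp: inverted_exterior_def)
    then show "\<zeta> \<in> T" unfolding T_def by blast
  qed
  have "connected T"
    unfolding T_def
  proof (rule connected_continuous_image)
    show "connected (outside \<Omega>)"
      using assms by (intro connected_outside compact_imp_bounded) auto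
    show "continuous_on (outside \<Omega>) (\<lambda>w. inverse (w - a))"
      by (intro continuous_intros) (use a in auto)
  qed
  moreover have "T \<subseteq> inverted_exterior \<Omega> a" using T by auto
  moreover have "0 \<in> closure T"
  proof -
    obtain r where r: "r > 0" "ball 0 r \<subseteq> inverted_exterior \<Omega> a"
      using inverted_exterior_near_0[OF assms(1)] .
    show ?thesis
      unfolding closure_approachable
    proof (intro allI impI)
      fix e :: real assume "e > 0"
      define x where "x = min e r / 2"
      have x: "0 < x" "x < e" "x < r" using \<open>e > 0\<close> \<open>r > 0\<close> by (auto simp: x_def)
      then have "complex_of_real x \<in> ball 0 r" by simp
      then show "\<exists>y\<in>T. dist y 0 < e"
        using x r(2) by (intro bexI[of _ "of_real x"]) (auto simp: T)
    qed
  qed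
  then have "inverted_exterior \<Omega> a \<subseteq> closure T"
    using T closure_subset[of T] by auto
  ultimately show ?thesis by (rule connected_intermediate_closure)
qed

text \<open>A bounded component of the complement would by the Sura-Bura theorem lie in a compact relatively
  open part of it, whose image under the inversion is a clopen subset of the connected set
  \<open>\<Omega> \<union> inside \<Omega>\<close> that avoids \<open>a\<close>.\<close>

lemma simply_connected_inverted_exterior:
  assumes "compact \<Omega>" "connected \<Omega>" "a \<in> \<Omega>"
  shows "simply_connected (inverted_exterior \<Omega> a)"
proof -
  define S where "S = inverted_exterior \<Omega> a"
  define H where "H = \<Omega> \<union> inside \<Omega>"
  have "open S" unfolding S_def by (rule open_inverted_exterior[OF assms(1)])
  have H: "H = - outside \<Omega>" unfolding H_def by (rule union_with_inside)
  have "\<not> bounded C" if C: "C \<in> components (- S)" for C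
  proof
    assume "bounded C"
    have "closed (- S)" using \<open>open S\<close> by (rule closed_Compl)
    then have "compact C"
      using C \<open>bounded C\<close> closed_components compact_eq_bounded_closed by blast
    \<comment> \<open>The component \<open>C\<close> itself need not be relatively open, since other
      components may accumulate at it; \<open>K\<close> replaces it by a set that is.\<close>
    obtain K where K: "openin (top_of_set (- S)) K" "compact K" "C \<subseteq> K"
      using Sura_Bura_clopen_subset[OF closed_imp_locally_compact[OF \<open>closed (- S)\<close>] C \<open>compact C\<close>, of UNIV]
      by auto
    obtain O' where "open O'" and O': "K = - S \<inter> O'"
      using K(1) by (auto simp: openin_open)
    have "0 \<notin> K" using O' by (auto simp: S_def inverted_exterior_def)
    define L where "L = (\<lambda>\<zeta>. a + inverse \<zeta>) ` K"
    have "compact L"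
      unfolding L_def
      by (intro compact_continuous_image \<open>compact K\<close> continuous_intros) (use \<open>0 \<notin> K\<close> in auto)
    \<comment> \<open>The inversion is not continuous at \<open>a\<close>, where it takes the
      default value \<open>inverse 0 = 0\<close>. Removing \<open>a\<close> makes \<open>Q\<close>
      open and shows that \<open>L\<close> misses \<open>a\<close>.\<close>
    define Q where "Q = (- {a}) \<inter> (\<lambda>w. inverse (w - a)) -` O'"
    have "open Q"
      unfolding Q_def by (intro continuous_open_preimage \<open>open O'\<close> continuous_intros) auto
    have L: "L = H \<inter> Q"
    proof (intro equalityI subsetI)
      fix w assume "w \<in> L"
      then obtain \<zeta> where \<zeta>: "\<zeta> \<in> K" "w = a + inverse \<zeta>" by (auto simp: L_def)
      then have "\<zeta> \<noteq> 0" using \<open>0 \<notin> K\<close> by auto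
      then show "w \<in> H \<inter> Q"
        using \<zeta> O' by (auto simp: H Q_def S_def inverted_exterior_def)
    next
      fix w assume w: "w \<in> H \<inter> Q"
      then have "inverse (w - a) \<in> K"
        using O' by (auto simp: H Q_def S_def inverted_exterior_def)
      moreover have "w = a + inverse (inverse (w - a))" by simp
      ultimately show "w \<in> L" unfolding L_def by blast
    qed
    have "connected H"
      unfolding H_def using assms by (intro connected_with_inside compact_imp_closed)
    moreover have "openin (top_of_set H) L" using \<open>open Q\<close> L by (auto simp: openin_open)
    moreover have "closedin (top_of_set H) L"
      using L compact_imp_closed[OF \<open>compact L\<close>] by (auto simp: closedin_closed)
    ultimately have "L = {} \<or> L = H" unfolding connected_clopen by blast
    moreover have "L \<noteq> {}" using in_components_nonempty[OF C] \<open>C \<subseteq> K\<close> by (auto simp: L_def)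
    moreover have "a \<in> H" "a \<notin> L" using assms(3) L by (auto simp: H_def Q_def)
    ultimately show False by blast
  qed
  then show ?thesis
    using simply_connected_eq_unbounded_complement_components[OF \<open>open S\<close>]
      connected_inverted_exterior[OF assms(1,3)] by (simp add: S_def)
qed

text \<open>A Moebius automorphism of the disc moves the image of 0 back to 0. As 0 is the
  coordinate of infinity, this places the logarithmic pole of the Green function there.\<close>

lemma Riemann_map_fixing_0:
  assumes "open S" "simply_connected S" "S \<noteq> UNIV" "0 \<in> S"
  shows "\<exists>f g. f holomorphic_on S \<and> g holomorphic_on ball 0 1 \<and> f 0 = 0 \<and>
    (\<forall>z\<in>S. cmod (f z) < 1 \<and> g (f z) = z) \<and> (\<forall>z\<in>ball 0 1. g z \<in> S)"
proof -
  have "S \<noteq> {}" using assms(4) by auto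
  then have "\<exists>f g. f holomorphic_on S \<and> g holomorphic_on ball 0 1 \<and>
      (\<forall>z\<in>S. f z \<in> ball 0 1 \<and> g (f z) = z) \<and> (\<forall>z\<in>ball 0 1. g z \<in> S \<and> f (g z) = z)"
    using iffD1[OF Riemann_mapping_theorem conjI[OF assms(1,2)]] assms(3) by simp
  then obtain f g where fg0: "f holomorphic_on S \<and> g holomorphic_on ball 0 1 \<and>
      (\<forall>z\<in>S. f z \<in> ball 0 1 \<and> g (f z) = z) \<and> (\<forall>z\<in>ball 0 1. g z \<in> S \<and> f (g z) = z)"
    by (elim exE)
  have f: "f holomorphic_on S" and g: "g holomorphic_on ball 0 1"
    and fg: "\<And>z. z \<in> S \<Longrightarrow> f z \<in> ball 0 1 \<and> g (f z) = z"
    and gf: "\<And>z. z \<in> ball 0 1 \<Longrightarrow> g z \<in> S"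
    using fg0 by blast+
  have "f 0 \<in> ball 0 1" using fg assms(4) by blast
  then have a: "cmod (f 0) < 1" by simp
  define h where "h = Moebius_function 0 (f 0)"
  define k where "k = Moebius_function 0 (- f 0)"
  have hk: "h (f 0) = 0" "h holomorphic_on ball 0 1" "k holomorphic_on ball 0 1"
    using a by (simp_all add: h_def k_def Moebius_function_eq_zero Moebius_function_holomorphic)
  have hk1: "cmod (h z) < 1" "cmod (k z) < 1" "k (h z) = z" if "cmod z < 1" for z
    using a that
    by (simp_all add: h_def k_def Moebius_function_norm_lt_1 Moebius_function_compose)
  show ?thesis
  proof (rule exI[of _ "h \<circ> f"], rule exI[of _ "g \<circ> k"], intro conjI ballI)
    show "h \<circ> f holomorphic_on S"
      by (rule holomorphic_on_compose_gen[OF f hk(2)]) (use fg in blast)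
    show "g \<circ> k holomorphic_on ball 0 1"
      by (rule holomorphic_on_compose_gen[OF hk(3) g]) (use hk1 in auto)
    show "cmod ((h \<circ> f) z) < 1" "(g \<circ> k) ((h \<circ> f) z) = z" if "z \<in> S" for z
      using fg[OF that] hk1[of "f z"] by simp_all
    show "(g \<circ> k) z \<in> S" if "z \<in> ball 0 1" for z
      using gf hk1(2)[of z] that by simp
  qed (use hk in simp)
qed

text \<open>The only zero of the Riemann map is the coordinate of infinity, so minus the logarithm
  of its modulus is harmonic at all finite exterior points. Boundary values follow from properness
  of the map, the growth at infinity from its nonzero derivative at 0.\<close>

lemma exterior_laplace_exists:
  assumes "compact \<Omega>" "connected \<Omega>" "a \<in> \<Omega>" "b \<in> \<Omega>" "a \<noteq> b"
  shows "\<exists>G. solves_exterior_laplace \<Omega> G"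
proof -
  define S where "S = inverted_exterior \<Omega> a"
  define \<phi> where "\<phi> = (\<lambda>w. inverse (w - a))"
  have "closed \<Omega>" using assms compact_imp_closed by blast
  have "open S" unfolding S_def by (rule open_inverted_exterior[OF assms(1)])
  have notout: "w \<notin> outside \<Omega>" if "w \<in> \<Omega>" for w using that outside_no_overlap by blast
  \<comment> \<open>The case \<open>w = a\<close> stems from \<open>inverse 0 = 0\<close>: the
    default value \<open>\<phi> a\<close> coincides with the coordinate of infinity.\<close>
  have S: "\<phi> w \<in> S \<longleftrightarrow> w = a \<or> w \<in> outside \<Omega>" for w
    by (simp add: S_def \<phi>_def inverted_exterior_def)
  have "0 \<in> S" by (simp add: S_def inverted_exterior_def)
  \<comment> \<open>The second point of \<Omega> supplies the omitted value that the Riemann mapping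
    theorem demands; \<open>\<phi> a\<close> is 0 and lies in \<open>S\<close>.\<close>
  have "\<phi> b \<notin> S" using S[of b] notout assms by auto
  then have "S \<noteq> UNIV" by auto
  have "simply_connected S" unfolding S_def by (rule simply_connected_inverted_exterior[OF assms(1-3)])
  obtain f g where fg: "f holomorphic_on S \<and> g holomorphic_on ball 0 1 \<and> f 0 = 0 \<and>
      (\<forall>z\<in>S. cmod (f z) < 1 \<and> g (f z) = z) \<and> (\<forall>z\<in>ball 0 1. g z \<in> S)"
    using Riemann_map_fixing_0[OF \<open>open S\<close> \<open>simply_connected S\<close> \<open>S \<noteq> UNIV\<close> \<open>0 \<in> S\<close>]
    by (elim exE)
  then have f: "f holomorphic_on S" and g: "g holomorphic_on ball 0 1" and "f 0 = 0"
    and f1: "\<And>z. z \<in> S \<Longrightarrow> cmod (f z) < 1" and gf: "\<And>z. z \<in> S \<Longrightarrow> g (f z) = z"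
    and gS: "\<And>z. z \<in> ball 0 1 \<Longrightarrow> g z \<in> S"
    by blast+
  have "inj_on f S" by (rule inj_on_inverseI[of _ g]) (rule gf)
  have f0: "f \<zeta> = 0 \<longleftrightarrow> \<zeta> = 0" if "\<zeta> \<in> S" for \<zeta>
    using inj_onD[OF \<open>inj_on f S\<close> _ that \<open>0 \<in> S\<close>] \<open>f 0 = 0\<close> by auto
  \<comment> \<open>The value 1 turns \<open>G\<close> into 0 on \<Omega> and on the bounded
    components alike, and makes \<open>F\<close> one zero-free holomorphic function on the whole
    complement.\<close>
  define F where "F = (\<lambda>w. if w \<in> outside \<Omega> then f (\<phi> w) else 1)"
  define G where "G = (\<lambda>w. - ln (cmod (F w)))"
  have "open (outside \<Omega>)" "open (inside \<Omega>)"
    using \<open>closed \<Omega>\<close> open_outside open_inside by blast+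
  have disj: "w \<notin> inside \<Omega>" if "w \<in> outside \<Omega>" for w
    using that inside_Int_outside[of \<Omega>] by blast
  have "(f \<circ> \<phi>) holomorphic_on outside \<Omega>"
  proof (rule holomorphic_on_compose_gen[OF _ f])
    show "\<phi> holomorphic_on outside \<Omega>"
      unfolding \<phi>_def by (intro holomorphic_intros) (use notout assms in auto)
  qed (use S in auto)
  then have "F holomorphic_on outside \<Omega> \<union> inside \<Omega>"
    unfolding F_def comp_def
    by (rule holomorphic_on_If_Un[OF _ _ \<open>open (outside \<Omega>)\<close> \<open>open (inside \<Omega>)\<close>])
      (auto dest: disj)
  then have holF: "F holomorphic_on - \<Omega>" by (metis Un_commute inside_Un_outside)
  have Fnz: "F w \<noteq> 0" for w
    using f0[of "\<phi> w"] S[of w] notout[OF assms(3)] by (auto simp: F_def \<phi>_def)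
  have "cmod (F w) \<le> 1" for w
    using f1[of "\<phi> w"] S[of w] by (auto simp: F_def)
  then have Gnn: "G w \<ge> 0" for w using Fnz[of w] by (simp add: G_def)
  have G0: "G w = 0" if "w \<notin> outside \<Omega>" for w using that by (simp add: G_def F_def)
  have "harmonic_on (\<lambda>w. (-1) * ln (cmod (F w)) + 0 * 0) (- \<Omega>)"
    by (intro harmonic_on_linear_combination harmonic_on_const harmonic_on_ln_cmod holF Fnz)
      (use \<open>closed \<Omega>\<close> in auto)
  then have harm: "harmonic_on G (- \<Omega>)" by (simp add: G_def)
  have cont: "isCont G w0" for w0
  proof (cases "w0 \<in> outside \<Omega>")
    case True
    have "continuous_on (outside \<Omega>) G"
      unfolding G_def using notout Fnz
      by (intro continuous_intros continuous_on_subset[OF holomorphic_on_imp_continuous_on[OF holF]]) auto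
    then show ?thesis using True \<open>open (outside \<Omega>)\<close> continuous_on_eq_continuous_at by blast
  next
    case False
    have "(G \<longlongrightarrow> 0) (at w0)"
    proof (rule tendstoI)
      fix e :: real assume "e > 0"
      have sub: "cball 0 (exp (- e)) \<subseteq> (ball 0 1 :: complex set)"
        using \<open>e > 0\<close> by (simp add: cball_subset_ball_iff)
      \<comment> \<open>In the coordinate \<open>\<phi>\<close>, exterior points with
        \<open>G w \<ge> e\<close> correspond to |f| \<le> exp (- e) and so lie in \<open>T\<close>.
        Since \<open>T\<close> is a compact subset of \<open>S\<close>, \<open>\<phi> w\<close>
        leaves it as \<open>w\<close> approaches a point outside the exterior.\<close>
      define T where "T = g ` cball 0 (exp (- e))"
      have "compact T"
        unfolding T_def
        by (intro compact_continuous_image sub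
            continuous_on_subset[OF holomorphic_on_imp_continuous_on[OF g]]) simp
      have "T \<subseteq> S" unfolding T_def using gS sub by blast
      have small: "dist (G w) 0 < e" if "\<phi> w \<notin> T" for w
      proof (cases "w \<in> outside \<Omega>")
        case True
        then have "\<phi> w \<in> S" using S by simp
        have "f (\<phi> w) \<notin> cball 0 (exp (- e))"
        proof
          assume "f (\<phi> w) \<in> cball 0 (exp (- e))"
          then have "g (f (\<phi> w)) \<in> T" unfolding T_def by (rule imageI)
          with that gf[OF \<open>\<phi> w \<in> S\<close>] show False by simp
        qed
        then have "exp (- e) < cmod (F w)" using True by (simp add: F_def)
        then have "ln (exp (- e)) < ln (cmod (F w))"
          using Fnz[of w] by (subst ln_less_cancel_iff) auto
        then show ?thesis using Gnn[of w] by (simp add: G_def)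
      qed (use \<open>e > 0\<close> G0 in simp)
      have "eventually (\<lambda>w. \<phi> w \<notin> T) (at w0)"
      \<comment> \<open>At \<open>a\<close> the default value of \<open>\<phi>\<close> says nothing
        about nearby points: there \<open>\<phi>\<close> tends to infinity and leaves the bounded
        set \<open>T\<close>. Elsewhere \<open>\<phi>\<close> is continuous and \<open>T\<close> is
        closed.\<close>
      proof (cases "w0 = a")
        case True
        obtain B where B: "\<And>x. x \<in> T \<Longrightarrow> cmod x \<le> B"
          using compact_imp_bounded[OF \<open>compact T\<close>] by (auto simp: bounded_iff)
        have "filterlim (\<lambda>w. w - a) (at 0) (at a)"
          by (rule filterlim_atI) (auto intro!: tendsto_eq_intros simp: eventually_at_filter)
        then have "filterlim \<phi> at_infinity (at a)"
          unfolding \<phi>_def by (rule filterlim_compose[OF filterlim_inverse_at_infinity])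
        then have "\<forall>r>0. eventually (\<lambda>w. r \<le> cmod (\<phi> w)) (at a)"
          unfolding filterlim_at_infinity[OF order_refl] .
        then have "eventually (\<lambda>w. max 1 (B + 1) \<le> cmod (\<phi> w)) (at a)"
          by (rule allE[of _ "max 1 (B + 1)"]) simp
        moreover have "\<phi> w \<notin> T" if "max 1 (B + 1) \<le> cmod (\<phi> w)" for w
          using B[of "\<phi> w"] that by auto
        ultimately show ?thesis unfolding True by (rule eventually_mono)
      next
        case False
        have "\<phi> w0 \<notin> T" using \<open>T \<subseteq> S\<close> S[of w0] False \<open>w0 \<notin> outside \<Omega>\<close> by auto
        have "(\<phi> \<longlongrightarrow> \<phi> w0) (at w0)"
          unfolding \<phi>_def using False by (intro tendsto_intros) auto
        from topological_tendstoD[OF this, of "- T"] show ?thesis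
          using \<open>\<phi> w0 \<notin> T\<close> open_Compl[OF compact_imp_closed[OF \<open>compact T\<close>]] by simp
      qed
      then show "eventually (\<lambda>w. dist (G w) 0 < e) (at w0)"
        by (rule eventually_mono) (rule small)
    qed
    then show ?thesis using G0[OF False] by (simp add: isCont_def)
  qed
  \<comment> \<open>Near infinity |f (\<phi> w)| behaves like |d| / |w|, so
    \<open>G w - ln (cmod w)\<close> tends to - ln |d|; the number |d| is the logarithmic capacity
    of \<Omega>.\<close>
  define d where "d = deriv f 0"
  have "d \<noteq> 0"
    unfolding d_def by (rule holomorphic_injective_imp_regular[OF f \<open>open S\<close> \<open>inj_on f S\<close> \<open>0 \<in> S\<close>])
  have shift: "filterlim (\<lambda>w. w - a) at_infinity at_infinity"
    using tendsto_add_filterlim_at_infinity'[OF filterlim_ident tendsto_const[of "- a"]] by simp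
  have "filterlim \<phi> (at 0) at_infinity"
    unfolding \<phi>_def using shift by (simp add: filterlim_inverse_at_iff)
  moreover have "((\<lambda>\<zeta>. f \<zeta> / \<zeta>) \<longlongrightarrow> d) (at 0)"
    using holomorphic_derivI[OF f \<open>open S\<close> \<open>0 \<in> S\<close>] \<open>f 0 = 0\<close>
    by (simp add: d_def has_field_derivative_iff)
  ultimately have quot: "((\<lambda>w. f (\<phi> w) / \<phi> w) \<longlongrightarrow> d) at_infinity"
    by (rule filterlim_compose[rotated])
  \<comment> \<open>This factor corrects for an inversion centred at \<open>a\<close>, while the
    normalisation refers to |w|.\<close>
  have one: "((\<lambda>w. 1 - a / w) \<longlongrightarrow> 1 - 0) at_infinity"
    by (intro tendsto_intros tendsto_divide_0[OF tendsto_const] filterlim_ident)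
  have lim: "((\<lambda>w. ln (cmod (1 - a / w)) - ln (cmod (f (\<phi> w) / \<phi> w))) \<longlongrightarrow>
      ln (cmod (1 - 0)) - ln (cmod d)) at_infinity"
    by (intro tendsto_diff[OF tendsto_ln[OF tendsto_norm[OF one]] tendsto_ln[OF tendsto_norm[OF quot]]])
      (use \<open>d \<noteq> 0\<close> in auto)
  have ev_out: "eventually (\<lambda>w. w \<in> outside \<Omega>) at_infinity"
  proof -
    obtain B where B: "\<And>x. x \<in> - outside \<Omega> \<Longrightarrow> cmod x \<le> B"
      using cobounded_outside[OF compact_imp_bounded[OF assms(1)]] by (auto simp: bounded_iff)
    have "w \<in> outside \<Omega>" if "B + 1 \<le> cmod w" for w using B[of w] that by auto
    then show ?thesis by (auto simp: eventually_at_infinity)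
  qed
  have ev_nz: "eventually (\<lambda>w. (w::complex) \<noteq> 0) at_infinity"
    by (auto simp: eventually_at_infinity intro!: exI[of _ 1])
  have "eventually (\<lambda>w. ln (cmod (1 - a / w)) - ln (cmod (f (\<phi> w) / \<phi> w)) = G w - ln (cmod w)) at_infinity"
    using ev_out ev_nz
  proof eventually_elim
    case (elim w)
    have "w \<noteq> a" using elim(1) notout assms by auto
    have "f (\<phi> w) \<noteq> 0" using Fnz[of w] elim by (simp add: F_def)
    have "1 - a / w = (w - a) / w" using elim by (simp add: field_simps)
    moreover have "f (\<phi> w) / \<phi> w = f (\<phi> w) * (w - a)" by (simp add: \<phi>_def divide_inverse)
    ultimately show ?case
      using elim \<open>w \<noteq> a\<close> \<open>f (\<phi> w) \<noteq> 0\<close>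
      by (simp add: G_def F_def norm_divide norm_mult ln_div ln_mult)
  qed
  from tendsto_cong[OF this] lim
  have "((\<lambda>w. G w - ln (cmod w)) \<longlongrightarrow> ln (cmod (1 - 0)) - ln (cmod d)) at_infinity" by simp
  moreover have "filterlim (\<lambda>w::complex. ln (cmod w)) at_infinity at_infinity"
    by (rule filterlim_at_top_imp_at_infinity[OF ln_cmod_at_infinity])
  ultimately have "((\<lambda>w. (G w - ln (cmod w)) / ln (cmod w)) \<longlongrightarrow> 0) at_infinity"
    by (rule tendsto_divide_0)
  moreover have "eventually (\<lambda>w::complex. ln (cmod w) \<noteq> 0) at_infinity"
    using filterlim_at_top_dense[THEN iffD1, OF ln_cmod_at_infinity, rule_format, of 0]
    by (rule eventually_mono) simp
  ultimately have "G \<sim>[at_infinity] (\<lambda>w. ln (cmod w))"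
    by (intro smallo_imp_asymp_equiv smalloI_tendsto)
  then have "solves_exterior_laplace \<Omega> G"
    using cont harm G0 notout by (auto simp: solves_exterior_laplace_def continuous_on_eq_continuous_at)
  then show ?thesis by blast
qed

section \<open>Coefficients, interpolation and the Lebesgue constant\<close>

text \<open>Discrete orthogonality of the powers of a primitive root of unity turns the mean of
  |p|^2 over the roots into the sum of the squared coefficients, and a mean is at most the
  maximum.\<close>

lemma sum_norm_squares_le_sup_circle:
  fixes p :: "complex poly"
  assumes "degree p \<le> N" and K: "\<And>w. cmod w = 1 \<Longrightarrow> cmod (poly p w) \<le> K"
  shows "(\<Sum>k\<le>N. (cmod (coeff p k))\<^sup>2) \<le> K\<^sup>2"
proof -
  \<comment> \<open>One root more than the degree bound: the exponents 0, ..., N must be distinct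
    modulo \<open>n\<close>.\<close>
  define n where "n = Suc N"
  define \<omega> where "\<omega> = cis (2 * pi / real n)"
  have [simp]: "cmod \<omega> = 1" by (simp add: \<omega>_def)
  have pow: "\<omega> ^ k = cis (2 * pi * real k / real n)" for k
    by (simp add: \<omega>_def Complex.DeMoivre field_simps)
  have "\<omega> ^ n = 1" unfolding pow by (simp add: n_def)
  have inj: "\<omega> ^ k = \<omega> ^ l \<Longrightarrow> k < n \<Longrightarrow> l < n \<Longrightarrow> k = l" for k l
    using inj_onD[OF bij_betw_imp_inj_on[OF Complex.bij_betw_roots_unity[of n]]]
    unfolding pow by (simp add: n_def)
  have ortho: "(\<Sum>j<n. (\<omega> ^ k * cnj (\<omega> ^ l)) ^ j) = (if k = l then of_nat n else 0)"
    if "k < n" "l < n" for k l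
  proof -
    \<comment> \<open>This is the power of \<omega> with exponent k - l, the conjugate serving as
      the inverse. It is an n-th root of unity, so its geometric sum vanishes unless it equals
      1.\<close>
    define x where "x = \<omega> ^ k * cnj (\<omega> ^ l)"
    have x1: "x * \<omega> ^ l = \<omega> ^ k"
    proof -
      have "\<omega> ^ l * cnj (\<omega> ^ l) = 1" using complex_norm_square[of "\<omega> ^ l"] by (simp add: norm_power)
      then show ?thesis unfolding x_def by (metis mult.assoc mult.commute mult_1_right)
    qed
    have "x ^ n = (\<omega> ^ n) ^ k * cnj ((\<omega> ^ n) ^ l)"
      by (simp add: x_def power_mult_distrib mult.commute flip: power_mult)
    then have "x ^ n = 1" using \<open>\<omega> ^ n = 1\<close> by simp
    moreover have "x = 1 \<longleftrightarrow> k = l"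
      using x1 inj[OF _ that] by (auto simp: \<omega>_def)
    ultimately show ?thesis unfolding x_def[symmetric] sum_gp_strict by simp
  qed
  have p: "poly p x = (\<Sum>k<n. coeff p k * x ^ k)" for x
    unfolding n_def lessThan_Suc_atMost poly_altdef
    using assms(1) by (intro sum.mono_neutral_left) (auto simp: coeff_eq_0)
  have "(\<Sum>j<n. complex_of_real ((cmod (poly p (\<omega> ^ j)))\<^sup>2))
      = (\<Sum>j<n. (\<Sum>k<n. coeff p k * (\<omega> ^ j) ^ k) * cnj (\<Sum>l<n. coeff p l * (\<omega> ^ j) ^ l))"
    by (simp only: complex_norm_square p)
  also have "\<dots> = (\<Sum>j<n. \<Sum>k<n. \<Sum>l<n. coeff p k * cnj (coeff p l) * (\<omega> ^ k * cnj (\<omega> ^ l)) ^ j)"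
    by (intro sum.cong refl)
      (simp add: sum_product power_mult_distrib mult_ac flip: power_mult)
  also have "\<dots> = (\<Sum>k<n. \<Sum>j<n. \<Sum>l<n. coeff p k * cnj (coeff p l) * (\<omega> ^ k * cnj (\<omega> ^ l)) ^ j)"
    by (rule sum.swap)
  also have "\<dots> = (\<Sum>k<n. \<Sum>l<n. \<Sum>j<n. coeff p k * cnj (coeff p l) * (\<omega> ^ k * cnj (\<omega> ^ l)) ^ j)"
    by (rule sum.cong[OF refl], rule sum.swap)
  also have "\<dots> = (\<Sum>k<n. \<Sum>l<n. coeff p k * cnj (coeff p l) * (\<Sum>j<n. (\<omega> ^ k * cnj (\<omega> ^ l)) ^ j))"
    by (simp only: sum_distrib_left)
  also have "\<dots> = (\<Sum>k<n. \<Sum>l<n. coeff p k * cnj (coeff p l) * (if k = l then of_nat n else 0))"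
    by (intro sum.cong refl) (simp only: ortho lessThan_iff)
  also have "\<dots> = (\<Sum>k<n. \<Sum>l<n. if k = l then of_nat n * (coeff p k * cnj (coeff p l)) else 0)"
    by (intro sum.cong refl) simp
  also have "\<dots> = (\<Sum>k<n. of_nat n * of_real ((cmod (coeff p k))\<^sup>2))"
    by (simp only: complex_norm_square) simp
  finally have "complex_of_real (\<Sum>j<n. (cmod (poly p (\<omega> ^ j)))\<^sup>2)
      = complex_of_real (real n * (\<Sum>k<n. (cmod (coeff p k))\<^sup>2))"
    by (simp add: sum_distrib_left)
  then have "real n * (\<Sum>k<n. (cmod (coeff p k))\<^sup>2) = (\<Sum>j<n. (cmod (poly p (\<omega> ^ j)))\<^sup>2)"
    by (simp only: of_real_eq_iff)
  also have "\<dots> \<le> (\<Sum>j<n. K\<^sup>2)"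
    by (intro sum_mono power_mono K) (auto simp: norm_power)
  finally show ?thesis by (simp add: n_def lessThan_Suc_atMost)
qed

section \<open>Lagrange interpolation and finiteness of the Lebesgue constant\<close>

definition lagrange_basis :: "nat \<Rightarrow> (nat \<Rightarrow> complex) \<Rightarrow> nat \<Rightarrow> complex poly" where
  "lagrange_basis N z j = (\<Prod>i\<in>{..N} - {j}. Polynomial.smult (inverse (z j - z i)) [:- z i, 1:])"

lemma degree_lagrange_basis:
  assumes "j \<le> N"
  shows "degree (lagrange_basis N z j) \<le> N"
proof -
  have "degree (lagrange_basis N z j)
      \<le> sum (degree \<circ> (\<lambda>i. Polynomial.smult (inverse (z j - z i)) [:- z i, 1:])) ({..N} - {j})"
    unfolding lagrange_basis_def by (rule degree_prod_sum_le) simp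
  also have "\<dots> \<le> (\<Sum>i\<in>{..N} - {j}. 1)"
    by (intro sum_mono) (auto intro: order_trans[OF degree_smult_le])
  also have "\<dots> = N" using assms by simp
  finally show ?thesis .
qed

lemma poly_lagrange_basis:
  assumes "inj_on z {0..N}" "j \<le> N" "i \<le> N"
  shows "poly (lagrange_basis N z j) (z i) = (if i = j then 1 else 0)"
proof (cases "i = j")
  case True
  have "poly (Polynomial.smult (inverse (z j - z k)) [:- z k, 1:]) (z j) = 1"
    if "k \<in> {..N} - {j}" for k
  proof -
    define d where "d = z j - z k"
    have "d \<noteq> 0" using assms that by (auto simp: d_def inj_on_def)
    moreover have "poly [:- z k, 1:] (z j) = d" by (simp add: d_def)
    ultimately show ?thesis by (simp add: poly_smult flip: d_def del: poly_pCons smult_pCons)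
  qed
  then have "(\<Prod>k\<in>{..N} - {j}. poly (Polynomial.smult (inverse (z j - z k)) [:- z k, 1:]) (z j)) = 1"
    by (rule prod.neutral[OF ballI])
  then show ?thesis
    by (simp only: True lagrange_basis_def poly_prod if_True refl)
next
  case False
  then show ?thesis using assms(3)
    by (auto simp: lagrange_basis_def poly_prod intro!: bexI[of _ i])
qed

text \<open>Evaluates the definite description: two polynomials of degree at most N that agree at N
  + 1 distinct nodes are equal.\<close>

lemma interp_poly_eqI:
  assumes "inj_on z {0..N}" "degree p \<le> N" "\<And>j. j \<le> N \<Longrightarrow> poly p (z j) = F (z j)"
  shows "interp_poly N z F = p"
  unfolding interp_poly_def
proof (rule the_equality)
  fix q assume q: "degree q \<le> N \<and> (\<forall>j\<le>N. poly q (z j) = F (z j))"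
  have "card (z ` {0..N}) = Suc N" using assms(1) by (simp add: card_image)
  then show "q = p"
    using assms q by (intro poly_eqI_degree[of "z ` {0..N}"]) auto
qed (use assms in auto)

text \<open>A formula linear in the finitely many nodal values, from which the interpolation
  operator is seen to be bounded.\<close>

lemma interp_poly_lagrange:
  assumes "inj_on z {0..N}"
  shows "interp_poly N z F = (\<Sum>j\<le>N. Polynomial.smult (F (z j)) (lagrange_basis N z j))"
proof (rule interp_poly_eqI[OF assms])
  show "degree (\<Sum>j\<le>N. Polynomial.smult (F (z j)) (lagrange_basis N z j)) \<le> N"
    by (intro degree_sum_le) (auto intro: order_trans[OF degree_smult_le] degree_lagrange_basis)
  show "poly (\<Sum>j\<le>N. Polynomial.smult (F (z j)) (lagrange_basis N z j)) (z i) = F (z i)" if "i \<le> N" for i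
  proof -
    have "poly (\<Sum>j\<le>N. Polynomial.smult (F (z j)) (lagrange_basis N z j)) (z i)
        = (\<Sum>j\<le>N. if i = j then F (z j) else 0)"
      unfolding poly_sum poly_smult using assms that by (intro sum.cong) (simp_all add: poly_lagrange_basis)
    then show ?thesis using that by simp
  qed
qed

lemma norm_le_sup_norm:
  assumes "compact \<Omega>" "continuous_on \<Omega> g" "w \<in> \<Omega>"
  shows "cmod (g w) \<le> sup_norm \<Omega> g"
  unfolding sup_norm_def
proof (rule cSUP_upper[OF assms(3)])
  have "compact ((\<lambda>w. cmod (g w)) ` \<Omega>)"
    using assms by (intro compact_continuous_image continuous_intros)
  then show "bdd_above ((\<lambda>w. cmod (g w)) ` \<Omega>)"
    by (intro bounded_imp_bdd_above compact_imp_bounded)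
qed

lemma sup_norm_le:
  assumes "\<Omega> \<noteq> {}" "\<And>w. w \<in> \<Omega> \<Longrightarrow> cmod (g w) \<le> c"
  shows "sup_norm \<Omega> g \<le> c"
  unfolding sup_norm_def using assms by (rule cSUP_least)

text \<open>A real supremum bounds its members only if they are bounded above. Here the sum of the
  sup norms of the Lagrange basis polynomials is an upper bound for all quotients.\<close>

lemma sup_norm_interp_poly_le:
  assumes inj: "inj_on z {0..N}" and "compact \<Omega>" and z: "z ` {0..N} \<subseteq> \<Omega>"
    and F: "continuous_on \<Omega> F" "w0 \<in> \<Omega>" "F w0 \<noteq> 0"
  shows "sup_norm \<Omega> (poly (interp_poly N z F)) \<le> lebesgue_constant N z \<Omega> * sup_norm \<Omega> F"
proof -
  have pos: "sup_norm \<Omega> F > 0"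
    if "continuous_on \<Omega> F" "w \<in> \<Omega>" "F w \<noteq> 0" for F :: "complex \<Rightarrow> complex" and w
    using norm_le_sup_norm[OF \<open>compact \<Omega>\<close> that(1,2)] that(3)
    by (meson less_le_trans zero_less_norm_iff)
  have "bdd_above ((\<lambda>F. sup_norm \<Omega> (poly (interp_poly N z F)) / sup_norm \<Omega> F) `
      {F. continuous_on \<Omega> F \<and> (\<exists>w\<in>\<Omega>. F w \<noteq> 0)})"
  proof (rule bdd_aboveI2)
    fix F :: "complex \<Rightarrow> complex" assume "F \<in> {F. continuous_on \<Omega> F \<and> (\<exists>w\<in>\<Omega>. F w \<noteq> 0)}"
    then obtain w1 where F: "continuous_on \<Omega> F" "w1 \<in> \<Omega>" "F w1 \<noteq> 0" by blast
    have "sup_norm \<Omega> (poly (interp_poly N z F))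
        \<le> sup_norm \<Omega> F * (\<Sum>j\<le>N. sup_norm \<Omega> (poly (lagrange_basis N z j)))"
    proof (rule sup_norm_le)
      fix w assume "w \<in> \<Omega>"
      have "cmod (poly (interp_poly N z F) w)
          \<le> (\<Sum>j\<le>N. cmod (F (z j)) * cmod (poly (lagrange_basis N z j) w))"
        unfolding interp_poly_lagrange[OF inj] poly_sum
        by (rule norm_sum[THEN order_trans]) (simp add: norm_mult)
      also have "\<dots> \<le> (\<Sum>j\<le>N. sup_norm \<Omega> F * sup_norm \<Omega> (poly (lagrange_basis N z j)))"
        using \<open>w \<in> \<Omega>\<close> z pos[OF F]
        by (intro sum_mono mult_mono norm_le_sup_norm[OF \<open>compact \<Omega>\<close>] F continuous_intros) auto
      finally show "cmod (poly (interp_poly N z F) w)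
          \<le> sup_norm \<Omega> F * (\<Sum>j\<le>N. sup_norm \<Omega> (poly (lagrange_basis N z j)))"
        by (simp only: sum_distrib_left)
    qed (use F in auto)
    then show "sup_norm \<Omega> (poly (interp_poly N z F)) / sup_norm \<Omega> F
        \<le> (\<Sum>j\<le>N. sup_norm \<Omega> (poly (lagrange_basis N z j)))"
      using pos[OF F] by (simp add: pos_divide_le_eq mult.commute)
  qed
  then have "sup_norm \<Omega> (poly (interp_poly N z F)) / sup_norm \<Omega> F \<le> lebesgue_constant N z \<Omega>"
    unfolding lebesgue_constant_def using F by (intro cSUP_upper) auto
  then show ?thesis using pos[OF F] by (simp add: pos_divide_le_eq)
qed

section \<open>The Vandermonde matrix as evaluation of coefficient vectors\<close>

lemma vandermonde_carrier [simp]: "vandermonde N z \<in> carrier_mat (Suc N) (Suc N)"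
  by (simp add: vandermonde_def)

definition vec_poly :: "complex vec \<Rightarrow> complex poly" where
  "vec_poly c = (\<Sum>k<dim_vec c. monom (vec_index c k) k)"

lemma coeff_vec_poly: "coeff (vec_poly c) k = (if k < dim_vec c then vec_index c k else 0)"
  by (simp add: vec_poly_def coeff_sum)

lemma degree_vec_poly: "dim_vec c = Suc N \<Longrightarrow> degree (vec_poly c) \<le> N"
  by (intro degree_le) (simp add: coeff_vec_poly)

lemma poly_vec_poly_vandermonde:
  assumes "c \<in> carrier_vec (Suc N)" "j \<le> N"
  shows "poly (vec_poly c) (z j) = vec_index (vandermonde N z *\<^sub>v c) j"
  using assms
  by (auto simp: vec_poly_def vandermonde_def poly_sum poly_monom scalar_prod_def
      lessThan_atLeast0 mult.commute intro!: sum.cong)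

text \<open>A kernel vector would be the coefficient vector of a polynomial of degree at most N
  interpolating zero data, hence 0 by uniqueness. This ensures that \<open>the\<close> is applied to
  a genuine inverse.\<close>

lemma mat_inverse_vandermonde:
  assumes "inj_on z {0..N}"
  obtains B where "mat_inverse (vandermonde N z) = Some B"
    "B \<in> carrier_mat (Suc N) (Suc N)" "vandermonde N z * B = 1\<^sub>m (Suc N)"
proof -
  have "Determinant.det (vandermonde N z) \<noteq> 0"
  proof
    assume "Determinant.det (vandermonde N z) = 0"
    then obtain c where c: "c \<in> carrier_vec (Suc N)" "c \<noteq> 0\<^sub>v (Suc N)"
        "vandermonde N z *\<^sub>v c = 0\<^sub>v (Suc N)"
      using iffD1[OF det_0_iff_vec_prod_zero_field[OF vandermonde_carrier]] by auto
    have "interp_poly N z (\<lambda>_. 0) = vec_poly c"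
      using c by (intro interp_poly_eqI[OF assms] degree_vec_poly) (auto simp: poly_vec_poly_vandermonde)
    moreover have "interp_poly N z (\<lambda>_. 0) = 0"
      by (intro interp_poly_eqI[OF assms]) auto
    ultimately have "vec_index c k = 0" if "k < Suc N" for k
      using coeff_vec_poly[of c k] c(1) that by simp
    then have "c = 0\<^sub>v (Suc N)"
      using c(1) by (intro eq_vecI) auto
    with c(2) show False by simp
  qed
  then have unit: "vandermonde N z \<in> Units (ring_mat TYPE(complex) (Suc N) ())"
    by (rule det_non_zero_imp_unit[OF vandermonde_carrier])
  have "mat_inverse (vandermonde N z) \<noteq> None"
  proof
    assume "mat_inverse (vandermonde N z) = None"
    from mat_inverse(1)[OF vandermonde_carrier this]
    have "vandermonde N z \<notin> Units (ring_mat TYPE(complex) (Suc N) ())" .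
    with unit show False by contradiction
  qed
  then obtain B where "mat_inverse (vandermonde N z) = Some B" by auto
  with mat_inverse(2)[OF vandermonde_carrier this] show thesis by (auto intro: that)
qed

section \<open>The bound on the inverse Vandermonde matrix\<close>

lemma rho_star_ge_1:
  assumes "{\<rho>. \<rho> > 1 \<and> ball 0 1 \<subseteq> level_region \<Omega> \<rho>} \<noteq> {}"
  shows "rho_star \<Omega> \<ge> 1"
  unfolding rho_star_def using assms by (rule cInf_greatest) auto

text \<open>Needed for the infimum in \<open>rho_star\<close> to be meaningful; it holds because
  \<open>G\<close> is bounded on the closed unit disc.\<close>

lemma level_region_covers_disc:
  assumes "solves_exterior_laplace \<Omega> (green_function \<Omega>)"
  shows "{\<rho>. \<rho> > 1 \<and> ball 0 1 \<subseteq> level_region \<Omega> \<rho>} \<noteq> {}"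
proof -
  have "compact (green_function \<Omega> ` cball 0 1)"
    using assms by (intro compact_continuous_image) (auto simp: solves_exterior_laplace_def intro: continuous_on_subset)
  then obtain B where B: "\<And>w. cmod w \<le> 1 \<Longrightarrow> \<bar>green_function \<Omega> w\<bar> \<le> B"
    using compact_imp_bounded by (fastforce simp: bounded_iff)
  \<comment> \<open>The added 1 makes the inequality for \<open>G\<close> strict, and together with
    the maximum it ensures \<open>\<rho> > 1\<close>.\<close>
  define \<rho> where "\<rho> = exp (max B 0 + 1)"
  have "\<rho> > 1" by (simp add: \<rho>_def)
  moreover have "ball 0 1 \<subseteq> level_region \<Omega> \<rho>"
  proof
    fix w :: complex assume "w \<in> ball 0 1"
    then have "green_function \<Omega> w < ln \<rho>" using B[of w] by (simp add: \<rho>_def)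
    then show "w \<in> level_region \<Omega> \<rho>" by (auto simp: level_region_def)
  qed
  ultimately show ?thesis by blast
qed

text \<open>The infimum need not be an admissible radius, and the level regions only cover the open
  disc. Both gaps close by continuity: the bound is a closed condition in the point and in
  \<rho>.\<close>

lemma poly_unit_disc_le_rho_star:
  assumes "closed \<Omega>" and G: "solves_exterior_laplace \<Omega> (green_function \<Omega>)"
    and "M > 0" and M: "\<And>w. w \<in> \<Omega> \<Longrightarrow> cmod (poly p w) \<le> M" and deg: "degree p \<le> N"
    and "cmod w \<le> 1"
  shows "cmod (poly p w) \<le> M * rho_star \<Omega> ^ N"
proof -
  define R where "R = {\<rho>. \<rho> > 1 \<and> ball 0 1 \<subseteq> level_region \<Omega> \<rho>}"
  have le: "cmod (poly p w) \<le> M * \<rho> ^ N" if "\<rho> \<in> R" for \<rho>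
  proof -
    have "\<rho> > 1" and sub: "ball 0 1 \<subseteq> level_region \<Omega> \<rho>" using that by (auto simp: R_def)
    have "cmod (poly p x) \<le> M * \<rho> ^ N" if "x \<in> ball 0 1" for x
    proof (cases "x \<in> \<Omega>")
      case True
      have "M * 1 \<le> M * \<rho> ^ N"
        using \<open>M > 0\<close> \<open>\<rho> > 1\<close> by (intro mult_left_mono one_le_power) auto
      then show ?thesis using M[OF True] by simp
    next
      case False
      then have "green_function \<Omega> x < ln \<rho>" using sub that by (auto simp: level_region_def)
      then have "exp (real N * green_function \<Omega> x) \<le> exp (real N * ln \<rho>)"
        by (simp add: mult_left_mono)
      also have "\<dots> = \<rho> ^ N" using \<open>\<rho> > 1\<close> by (simp add: exp_of_nat_mult)
      finally have "M * exp (real N * green_function \<Omega> x) \<le> M * \<rho> ^ N"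
        using \<open>M > 0\<close> by simp
      then show ?thesis
        using Bernstein_Walsh[OF \<open>closed \<Omega>\<close> G \<open>M > 0\<close> M deg, of x] by simp
    qed
    then have "ball 0 1 \<subseteq> {x. cmod (poly p x) \<le> M * \<rho> ^ N}" by blast
    moreover have "closed {x. cmod (poly p x) \<le> M * \<rho> ^ N}"
      by (intro closed_Collect_le continuous_intros)
    ultimately have "closure (ball 0 1) \<subseteq> {x. cmod (poly p x) \<le> M * \<rho> ^ N}"
      by (rule closure_minimal)
    then show ?thesis using \<open>cmod w \<le> 1\<close> by auto
  qed
  have "R \<noteq> {}" unfolding R_def by (rule level_region_covers_disc[OF G])
  moreover have "bdd_below R" by (rule bdd_belowI[of _ 1]) (simp add: R_def)
  ultimately have "Inf R \<in> closure R" by (rule closure_contains_Inf)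
  moreover have "closure R \<subseteq> {\<rho>. cmod (poly p w) \<le> M * \<rho> ^ N}"
    using le by (intro closure_minimal closed_Collect_le continuous_intros) auto
  ultimately show ?thesis by (auto simp: rho_star_def R_def)
qed

lemma solves_exterior_laplace_green_function:
  assumes "compact \<Omega>" "connected \<Omega>" "a \<in> \<Omega>" "b \<in> \<Omega>" "a \<noteq> b"
  shows "solves_exterior_laplace \<Omega> (green_function \<Omega>)"
  unfolding green_function_def
  using exterior_laplace_exists[OF assms] exterior_laplace_unique[OF compact_imp_closed[OF assms(1)]]
  by (metis theI)

lemma vec_norm2_pos:
  assumes "v \<in> carrier_vec n" "v \<noteq> 0\<^sub>v n"
  shows "vec_norm2 v > 0"
proof -
  obtain i where "i < n" "vec_index v i \<noteq> 0"
    using assms by (metis carrier_vecD eq_vecI index_zero_vec)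
  then have "0 < cmod (vec_index v i)" by simp
  also have "\<dots> \<le> vec_norm2 v"
    unfolding vec_norm2_def using \<open>i < n\<close> assms(1) by (intro member_le_L2_set) auto
  finally show ?thesis .
qed

theorem theorem2p5:
  fixes N :: nat and z :: "nat \<Rightarrow> complex" and \<Omega> :: "complex set"
  assumes "inj_on z {0..N}"
    and "compact \<Omega>"
    and "simply_connected \<Omega>"
    and "\<exists>a\<in>\<Omega>. \<exists>b\<in>\<Omega>. a \<noteq> b"
    and "z ` {0..N} \<subseteq> \<Omega>"
  shows "op_norm2 (the (mat_inverse (vandermonde N z)))
           \<le> rho_star \<Omega> ^ N * lebesgue_constant N z \<Omega>"
proof -
  have G: "solves_exterior_laplace \<Omega> (green_function \<Omega>)"
    using assms(2-4) simply_connected_imp_connected solves_exterior_laplace_green_function by blast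
  have "rho_star \<Omega> \<ge> 1" by (intro rho_star_ge_1 level_region_covers_disc G)
  obtain B where B: "mat_inverse (vandermonde N z) = Some B"
    "B \<in> carrier_mat (Suc N) (Suc N)" "vandermonde N z * B = 1\<^sub>m (Suc N)"
    using mat_inverse_vandermonde[OF assms(1)] by metis
  have main: "vec_norm2 (B *\<^sub>v v) / vec_norm2 v \<le> rho_star \<Omega> ^ N * lebesgue_constant N z \<Omega>"
    if v: "v \<in> carrier_vec (Suc N)" "v \<noteq> 0\<^sub>v (Suc N)" for v
  proof -
    define c where "c = B *\<^sub>v v"
    define p where "p = vec_poly c"
    have c: "c \<in> carrier_vec (Suc N)" using B(2) v(1) by (simp add: c_def)
    have "vandermonde N z *\<^sub>v c = (vandermonde N z * B) *\<^sub>v v"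
      unfolding c_def by (rule assoc_mult_mat_vec[symmetric, OF vandermonde_carrier B(2) v(1)])
    then have Vc: "vandermonde N z *\<^sub>v c = v" using B(3) v(1) by simp
    have pz: "poly p (z j) = vec_index v j" if "j \<le> N" for j
      unfolding p_def using poly_vec_poly_vandermonde[OF c that] Vc by simp
    have deg: "degree p \<le> N" using c by (simp add: p_def degree_vec_poly)
    have vpos: "vec_norm2 v > 0" by (rule vec_norm2_pos[OF v])
    have vle: "cmod (poly p (z j)) \<le> vec_norm2 v" if "j \<le> N" for j
      unfolding pz[OF that] vec_norm2_def using that v(1) by (intro member_le_L2_set) auto
    \<comment> \<open>The extension is bounded by the Euclidean norm of \<open>v\<close> because
      each nodal value, an entry of \<open>v\<close>, is.\<close>
    obtain F where contF: "continuous_on UNIV F"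
      and Fz: "\<And>x. x \<in> z ` {0..N} \<Longrightarrow> F x = poly p x"
      and Fle: "\<And>x. x \<in> UNIV \<Longrightarrow> norm (F x) \<le> vec_norm2 v"
    proof (rule Tietze[of "z ` {0..N}" "poly p" UNIV "vec_norm2 v"])
      show "continuous_on (z ` {0..N}) (poly p)" by (intro continuous_intros)
      show "closedin (top_of_set UNIV) (z ` {0..N})" by (simp add: finite_imp_closed)
    qed (use vpos vle in auto)
    have interp: "interp_poly N z F = p"
      by (rule interp_poly_eqI[OF assms(1) deg]) (simp add: Fz)
    \<comment> \<open>A nonzero nodal value makes \<open>F\<close> a competitor in the Lebesgue
      constant and \<open>M\<close> positive, as the Bernstein-Walsh bound requires.\<close>
    obtain i where i: "i \<le> N" "poly p (z i) \<noteq> 0"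
      using v pz by (metis carrier_vecD eq_vecI index_zero_vec less_Suc_eq_le)
    have zi: "z i \<in> \<Omega>" using assms(5) i(1) by auto
    define M where "M = sup_norm \<Omega> (poly p)"
    have le_M: "cmod (poly p w) \<le> M" if "w \<in> \<Omega>" for w
      unfolding M_def using that by (intro norm_le_sup_norm assms(2) continuous_intros)
    have "M > 0" using le_M[OF zi] i(2) by (meson less_le_trans zero_less_norm_iff)
    have "sup_norm \<Omega> F \<le> vec_norm2 v" using zi Fle by (intro sup_norm_le) auto
    have F: "continuous_on \<Omega> F" "F (z i) \<noteq> 0"
      using contF continuous_on_subset Fz[of "z i"] i by auto
    have M_le: "M \<le> lebesgue_constant N z \<Omega> * sup_norm \<Omega> F"
      using sup_norm_interp_poly_le[OF assms(1,2,5) F(1) zi F(2)] by (simp add: interp M_def)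
    have "sup_norm \<Omega> F \<ge> 0"
      using norm_le_sup_norm[OF assms(2) F(1) zi] norm_ge_zero order_trans by blast
    \<comment> \<open>The sign is what permits replacing the norm of \<open>F\<close> by the larger
      norm of \<open>v\<close>.\<close>
    then have "lebesgue_constant N z \<Omega> \<ge> 0"
      using M_le \<open>M > 0\<close> by (metis less_le_trans linorder_not_le mult_nonpos_nonneg order_less_imp_le)
    then have M_le: "M \<le> lebesgue_constant N z \<Omega> * vec_norm2 v"
      using M_le \<open>sup_norm \<Omega> F \<le> vec_norm2 v\<close> by (meson mult_left_mono order_trans)
    have "(\<Sum>k\<le>N. (cmod (coeff p k))\<^sup>2) \<le> (M * rho_star \<Omega> ^ N)\<^sup>2"
      by (intro sum_norm_squares_le_sup_circle[OF deg]
          poly_unit_disc_le_rho_star[OF compact_imp_closed[OF assms(2)] G \<open>M > 0\<close> le_M deg]) auto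
    moreover have "vec_norm2 c = sqrt (\<Sum>k\<le>N. (cmod (coeff p k))\<^sup>2)"
      using c by (auto simp: vec_norm2_def L2_set_def p_def coeff_vec_poly lessThan_Suc_atMost
          intro!: sum.cong)
    ultimately have "vec_norm2 c \<le> M * rho_star \<Omega> ^ N"
      using \<open>M > 0\<close> \<open>rho_star \<Omega> \<ge> 1\<close> by (simp add: real_sqrt_le_iff' real_le_lsqrt)
    also have "\<dots> \<le> (lebesgue_constant N z \<Omega> * vec_norm2 v) * rho_star \<Omega> ^ N"
      using M_le \<open>rho_star \<Omega> \<ge> 1\<close> by (intro mult_right_mono) auto
    finally show ?thesis
      using vpos by (simp add: c_def pos_divide_le_eq mult_ac)
  qed
  \<comment> \<open>A least-upper-bound argument for a real supremum needs a nonempty index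
    set.\<close>
  have "carrier_vec (Suc N) - {0\<^sub>v (Suc N)} \<noteq> ({} :: complex vec set)"
  proof -
    have "unit_vec (Suc N) 0 \<in> carrier_vec (Suc N) - {0\<^sub>v (Suc N) :: complex vec}"
      by (auto dest: arg_cong[where f = "\<lambda>v. vec_index v 0"])
    then show ?thesis by blast
  qed
  then have "op_norm2 B \<le> rho_star \<Omega> ^ N * lebesgue_constant N z \<Omega>"
    unfolding op_norm2_def using B(2) main by (intro cSUP_least) auto
  then show ?thesis using B(1) by simp
qed

end
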